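(* Let $E$ and $F$ be quasi-Banach function lattices over measure spaces $(\Omega,\mu)$ and $(\widetilde\Omega,\nu)$, respectively, and let $T:E\to F$ be a bounded linear operator. Let $\mathcal A$ be a filtration of $\Omega$ and let $T^{*}$ be the maximal operator based on $T$ associated to $\mathcal A$. Assume that $F$ has the Fatou property. If there exist $p,q$ such that $0<p<q\le\infty$, $E$ satisfies a lower $p$-estimate and $F$ satisfies an upper $q$-estimate, then $\|T^{*}\|_{E\to F}\le\delta\|T\|_{E\to F}$, where \[ \delta=\frac{(1+\kappa_q^{-\tau})^{1/q}}{\kappa_q^{-\tau/p}-((1+\kappa_q^{-\tau})^{p/q}-1)^{1/p}}\,\ell_{(p)}(E)\,u^{(q)}(F), \] with $\frac1\tau=\frac1p-\frac1q$ and $\kappa_q=\max\{2,2^{1/q}\}$. If $F$ is a Banach space and $q\ge1$, then (the inequality holds with) \[ \delta=\frac{2^{1/q}}{1-(2^{p/q}-1)^{1/p}}\,\ell_{(p)}(E)\,u^{(q)}(F). \]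
   Context: Measure spaces are complete and $\sigma$-finite; $L^0_\mu$ is the space of (equivalence classes of) real- or complex-valued measurable functions finite $\mu$-a.e. A quasi-norm satisfies the axioms of a norm except that the triangle inequality is replaced by $\|x+y\|\le\kappa(\|x\|+\|y\|)$ for some $\kappa\ge1$; a complete quasi-normed space is a quasi-Banach space. A quasi-Banach space $E\subset L^0_\mu$ is a quasi-Banach function lattice over $\Omega$ if $f\in E$, $g\in L^0_\mu$, $|g|\le|f|$ a.e. imply $g\in E$ and $\|g\|_E\le\|f\|_E$. For a quasi-Banach function lattice $X$, $0<p\le\infty$, $n\in\mathbb N$: $u^{(p),n}(X)$ is the least $C$ such that $\|\sum_{j=1}^n x_j\|_X\le C(\sum_{j=1}^n\|x_j\|_X^p)^{1/p}$ for all disjointly supported $x_1,\dots,x_n\in X$; $\ell_{(p),n}(X)$ is the least $C$ such that $(\sum_{j=1}^n\|x_j\|_X^p)^{1/p}\le C\|\sum_{j=1}^n x_j\|_X$ for all disjointly supported $x_1,\dots,x_n\in X$ (with $\max_j\|x_j\|_X$ in place of the $p$-sum when $p=\infty$). $X$ satisfies an upper $p$-estimate if $u^{(p)}(X)=\sup_n u^{(p),n}(X)<\infty$, and a lower $p$-estimate if $\ell_{(p)}(X)=\sup_n\ell_{(p),n}(X)<\infty$. Convention: $1/\infty=0$. $F$ has the Fatou property if for every measurable $f$: whenever $0\le f_j\in F$ $(j\in\mathbb N)$ increases to $f$ pointwise a.e., then $f\in F$ and $\|f_j\|_F\to\|f\|_F$. A filtration of $\Omega$ is a family $\mathcal A=\{A_\alpha:\alpha\in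 Q\}$ of measurable subsets of $\Omega$ indexed by a countable totally ordered set $Q$ such that $\alpha<\alpha'$ implies $A_\alpha\subset A_{\alpha'}$. The maximal operator based on $T$ associated to $\mathcal A$ is $T^*f=\sup_{\alpha\in Q}|T(f\chi_{A_\alpha})|$, $f\in E$. $\|T^*\|_{E\to F}$ is the least $C$ with $\|T^*f\|_F\le C\|f\|_E$ for all $f\in E$. *)

theory Defs
  imports "HOL-Analysis.Analysis"
begin

text \<open>
  Scalars range over a type of sort {real_normed_field, euclidean_space}; by the theorems of
  Frobenius and Gelfand--Mazur the only such fields, up to isometric isomorphism, are the reals and
  the complex numbers.  An element of \<open>L\<^sup>0\<close> is given by an everywhere finite measurable
  representative, and equality in \<open>L\<^sup>0\<close> is equality almost everywhere.  A space of functions is a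
  set \<open>E\<close> of representatives with a functional \<open>N\<close>, of which only the values on \<open>E\<close> matter.
\<close>

locale quasi_normed_function_space = complete_measure M + sigma_finite_measure M
  for M :: "'a measure" +
  fixes E :: "('a \<Rightarrow> 'k::{real_normed_field, euclidean_space}) set"
    and N :: "('a \<Rightarrow> 'k) \<Rightarrow> real"
  assumes subset_L0: "E \<subseteq> borel_measurable M"
    and zero_mem: "(\<lambda>w. 0) \<in> E"
    and add_mem: "f \<in> E \<Longrightarrow> g \<in> E \<Longrightarrow> (\<lambda>w. f w + g w) \<in> E"
    and scale_mem: "f \<in> E \<Longrightarrow> (\<lambda>w. c * f w) \<in> E"
    and qnorm_nonneg: "f \<in> E \<Longrightarrow> 0 \<le> N f"
    and qnorm_eq_0_iff: "f \<in> E \<Longrightarrow> N f = 0 \<longleftrightarrow> (AE w in M. f w = 0)"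
    and qnorm_scale: "f \<in> E \<Longrightarrow> N (\<lambda>w. c * f w) = norm c * N f"
    and quasi_triangle:
      "\<exists>\<kappa>\<ge>1. \<forall>f\<in>E. \<forall>g\<in>E. N (\<lambda>w. f w + g w) \<le> \<kappa> * (N f + N g)"

text \<open>The ideal property below also makes \<open>E\<close> and \<open>N\<close> invariant under a.e. modification.\<close>

locale quasi_banach_function_lattice = quasi_normed_function_space +
  assumes qnorm_complete:
      "(\<And>n. u n \<in> E) \<Longrightarrow>
       (\<And>e. 0 < e \<Longrightarrow> \<exists>k. \<forall>m\<ge>k. \<forall>n\<ge>k. N (\<lambda>w. u m w - u n w) < e) \<Longrightarrow>
       \<exists>g\<in>E. (\<lambda>n. N (\<lambda>w. u n w - g w)) \<longlonglongrightarrow> 0"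
    and ideal:
      "f \<in> E \<Longrightarrow> g \<in> borel_measurable M \<Longrightarrow> (AE w in M. norm (g w) \<le> norm (f w)) \<Longrightarrow>
       g \<in> E \<and> N g \<le> N f"

locale banach_function_lattice = quasi_banach_function_lattice +
  assumes triangle: "f \<in> E \<Longrightarrow> g \<in> E \<Longrightarrow> N (\<lambda>w. f w + g w) \<le> N f + N g"

definition disjointly_supported :: "'a measure \<Rightarrow> nat \<Rightarrow> (nat \<Rightarrow> 'a \<Rightarrow> 'k::zero) \<Rightarrow> bool" where
  "disjointly_supported M n x \<longleftrightarrow>
     (\<forall>i\<in>{1..n}. \<forall>j\<in>{1..n}. i \<noteq> j \<longrightarrow> (AE w in M. x i w = 0 \<or> x j w = 0))"

definition lp_sum :: "ennreal \<Rightarrow> nat \<Rightarrow> (nat \<Rightarrow> real) \<Rightarrow> real" where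
  "lp_sum p n a =
     (if p = \<infinity> then Max (a ` {1..n})
      else (\<Sum>j=1..n. a j powr enn2real p) powr (1 / enn2real p))"

text \<open>
  Each "least C" below is an infimum in \<open>[0,\<infinity>]\<close>, equal to \<open>\<infinity>\<close> if no finite constant works.
  The value \<open>C = \<infinity>\<close> is harmless although \<open>\<infinity> * 0 = 0\<close>, since in each inequality the left-hand side
  vanishes when the factor of \<open>C\<close> does.
\<close>

definition upper_const_n ::
  "('a \<Rightarrow> 'k::{real_normed_field, euclidean_space}) set \<Rightarrow> (('a \<Rightarrow> 'k) \<Rightarrow> real) \<Rightarrow> 'a measure \<Rightarrow>
   ennreal \<Rightarrow> nat \<Rightarrow> ennreal" where
  "upper_const_n E N M p n = Inf {C. \<forall>x. (\<forall>j\<in>{1..n}. x j \<in> E) \<and> disjointly_supported M n x \<longrightarrow>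
     ennreal (N (\<lambda>w. \<Sum>j=1..n. x j w)) \<le> C * ennreal (lp_sum p n (\<lambda>j. N (x j)))}"

definition lower_const_n ::
  "('a \<Rightarrow> 'k::{real_normed_field, euclidean_space}) set \<Rightarrow> (('a \<Rightarrow> 'k) \<Rightarrow> real) \<Rightarrow> 'a measure \<Rightarrow>
   ennreal \<Rightarrow> nat \<Rightarrow> ennreal" where
  "lower_const_n E N M p n = Inf {C. \<forall>x. (\<forall>j\<in>{1..n}. x j \<in> E) \<and> disjointly_supported M n x \<longrightarrow>
     ennreal (lp_sum p n (\<lambda>j. N (x j))) \<le> C * ennreal (N (\<lambda>w. \<Sum>j=1..n. x j w))}"

definition upper_const ::
  "('a \<Rightarrow> 'k::{real_normed_field, euclidean_space}) set \<Rightarrow> (('a \<Rightarrow> 'k) \<Rightarrow> real) \<Rightarrow> 'a measure \<Rightarrow>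
   ennreal \<Rightarrow> ennreal" where
  "upper_const E N M p = (SUP n\<in>{1..}. upper_const_n E N M p n)"

definition lower_const ::
  "('a \<Rightarrow> 'k::{real_normed_field, euclidean_space}) set \<Rightarrow> (('a \<Rightarrow> 'k) \<Rightarrow> real) \<Rightarrow> 'a measure \<Rightarrow>
   ennreal \<Rightarrow> ennreal" where
  "lower_const E N M p = (SUP n\<in>{1..}. lower_const_n E N M p n)"

definition upper_estimate ::
  "('a \<Rightarrow> 'k::{real_normed_field, euclidean_space}) set \<Rightarrow> (('a \<Rightarrow> 'k) \<Rightarrow> real) \<Rightarrow> 'a measure \<Rightarrow>
   ennreal \<Rightarrow> bool" where
  "upper_estimate E N M p \<longleftrightarrow> upper_const E N M p < \<infinity>"

definition lower_estimate ::
  "('a \<Rightarrow> 'k::{real_normed_field, euclidean_space}) set \<Rightarrow> (('a \<Rightarrow> 'k) \<Rightarrow> real) \<Rightarrow> 'a measure \<Rightarrow>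
   ennreal \<Rightarrow> bool" where
  "lower_estimate E N M p \<longleftrightarrow> lower_const E N M p < \<infinity>"

text \<open>
  The boundedness of the quasi-norms is the usual side condition of the Fatou property (equivalently,
  \<open>\<parallel>f\<parallel> = \<infinity>\<close> is allowed for \<open>f \<notin> F\<close>).  Without it only finite-dimensional lattices would qualify;
  in particular, the property stated without it implies the one below.
\<close>

definition fatou_property ::
  "('b \<Rightarrow> 'k::{real_normed_field, euclidean_space}) set \<Rightarrow> (('b \<Rightarrow> 'k) \<Rightarrow> real) \<Rightarrow> 'b measure \<Rightarrow>
   bool" where
  "fatou_property F N M \<longleftrightarrow>
     (\<forall>(f :: nat \<Rightarrow> 'b \<Rightarrow> real) g.
        g \<in> borel_measurable M \<longrightarrow>
        (\<forall>j. (\<lambda>w. of_real (f j w)) \<in> F) \<longrightarrow>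
        (AE w in M. \<forall>j. 0 \<le> f j w \<and> f j w \<le> f (Suc j) w) \<longrightarrow>
        (AE w in M. (\<lambda>j. f j w) \<longlonglongrightarrow> g w) \<longrightarrow>
        bdd_above (range (\<lambda>j. N (\<lambda>w. of_real (f j w)))) \<longrightarrow>
        (\<lambda>w. of_real (g w)) \<in> F \<and>
        (\<lambda>j. N (\<lambda>w. of_real (f j w))) \<longlonglongrightarrow> N (\<lambda>w. of_real (g w)))"

definition bounded_linear_operator ::
  "('a \<Rightarrow> 'k::{real_normed_field, euclidean_space}) set \<Rightarrow> (('a \<Rightarrow> 'k) \<Rightarrow> real) \<Rightarrow> 'a measure \<Rightarrow>
   ('b \<Rightarrow> 'k) set \<Rightarrow> (('b \<Rightarrow> 'k) \<Rightarrow> real) \<Rightarrow> 'b measure \<Rightarrow>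
   (('a \<Rightarrow> 'k) \<Rightarrow> ('b \<Rightarrow> 'k)) \<Rightarrow> bool" where
  "bounded_linear_operator E NE M F NF M' T \<longleftrightarrow>
     (\<forall>f\<in>E. T f \<in> F) \<and>
     (\<forall>f\<in>E. \<forall>g\<in>E. (AE w in M. f w = g w) \<longrightarrow> (AE w in M'. T f w = T g w)) \<and>
     (\<forall>f\<in>E. \<forall>g\<in>E. AE w in M'. T (\<lambda>w. f w + g w) w = T f w + T g w) \<and>
     (\<forall>c. \<forall>f\<in>E. AE w in M'. T (\<lambda>w. c * f w) w = c * T f w) \<and>
     (\<exists>C. \<forall>f\<in>E. NF (T f) \<le> C * NE f)"

definition operator_norm ::
  "('a \<Rightarrow> 'k) set \<Rightarrow> (('a \<Rightarrow> 'k) \<Rightarrow> real) \<Rightarrow> (('b \<Rightarrow> 'k) \<Rightarrow> real) \<Rightarrow>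
   (('a \<Rightarrow> 'k) \<Rightarrow> ('b \<Rightarrow> 'k)) \<Rightarrow> ennreal" where
  "operator_norm E NE NF T = Inf {C. \<forall>f\<in>E. ennreal (NF (T f)) \<le> C * ennreal (NE f)}"

definition filtration :: "'a measure \<Rightarrow> 'i::linorder set \<Rightarrow> ('i \<Rightarrow> 'a set) \<Rightarrow> bool" where
  "filtration M Q A \<longleftrightarrow>
     countable Q \<and> (\<forall>\<alpha>\<in>Q. A \<alpha> \<in> sets M) \<and>
     (\<forall>\<alpha>\<in>Q. \<forall>\<beta>\<in>Q. \<alpha> < \<beta> \<longrightarrow> A \<alpha> \<subseteq> A \<beta>)"

definition maximal_operator ::
  "'i set \<Rightarrow> ('i \<Rightarrow> 'a set) \<Rightarrow> (('a \<Rightarrow> 'k::real_normed_field) \<Rightarrow> ('b \<Rightarrow> 'k)) \<Rightarrow> ('a \<Rightarrow> 'k) \<Rightarrow> 'b \<Rightarrow> ennreal"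
  where
  "maximal_operator Q A T f w =
     (SUP \<alpha>\<in>Q. ennreal (norm (T (\<lambda>v. f v * indicator (A \<alpha>) v) w)))"

text \<open>The quasi-norm of a \<open>[0,\<infinity>]\<close>-valued function, set to \<open>\<infinity>\<close> if the function does not belong to \<open>F\<close>.\<close>

definition extended_qnorm ::
  "('b \<Rightarrow> 'k::real_normed_field) set \<Rightarrow> (('b \<Rightarrow> 'k) \<Rightarrow> real) \<Rightarrow> 'b measure \<Rightarrow> ('b \<Rightarrow> ennreal) \<Rightarrow> ennreal"
  where
  "extended_qnorm F N M g =
     (if (AE w in M. g w < \<infinity>) \<and> (\<lambda>w. of_real (enn2real (g w))) \<in> F
      then ennreal (N (\<lambda>w. of_real (enn2real (g w))))
      else \<infinity>)"

definition maximal_operator_norm ::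
  "('a \<Rightarrow> 'k::real_normed_field) set \<Rightarrow> (('a \<Rightarrow> 'k) \<Rightarrow> real) \<Rightarrow>
   ('b \<Rightarrow> 'k) set \<Rightarrow> (('b \<Rightarrow> 'k) \<Rightarrow> real) \<Rightarrow> 'b measure \<Rightarrow>
   'i set \<Rightarrow> ('i \<Rightarrow> 'a set) \<Rightarrow> (('a \<Rightarrow> 'k) \<Rightarrow> ('b \<Rightarrow> 'k)) \<Rightarrow> ennreal" where
  "maximal_operator_norm E NE F NF M' Q A T =
     Inf {C. \<forall>f\<in>E. extended_qnorm F NF M' (maximal_operator Q A T f) \<le> C * ennreal (NE f)}"

text \<open>\<open>1/q\<close> as a real number, with \<open>1/\<infinity> = 0\<close>.\<close>

definition recip :: "ennreal \<Rightarrow> real" where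
  "recip q = enn2real (inverse q)"

definition kappa :: "ennreal \<Rightarrow> real" where
  "kappa q = max 2 (2 powr recip q)"

definition tau :: "real \<Rightarrow> ennreal \<Rightarrow> real" where
  "tau p q = 1 / (1 / p - recip q)"

definition delta_quasi :: "real \<Rightarrow> ennreal \<Rightarrow> real" where
  "delta_quasi p q =
     (1 + kappa q powr (- tau p q)) powr recip q /
     (kappa q powr (- tau p q / p) -
      ((1 + kappa q powr (- tau p q)) powr (p * recip q) - 1) powr (1 / p))"

definition delta_banach :: "real \<Rightarrow> ennreal \<Rightarrow> real" where
  "delta_banach p q =
     2 powr recip q / (1 - (2 powr (p * recip q) - 1) powr (1 / p))"

end

theory Submission
  imports Defs
begin

text \<open>
  Fix \<open>f \<in> E\<close> and finitely many sets \<open>A\<^sub>j\<close> of the filtration.  The lower \<open>p\<close>-estimate makes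
  \<open>B \<mapsto> \<parallel>f \<chi>\<^sub>B\<parallel>\<^sup>p\<close> comparable to a superadditive set function \<open>\<phi>\<close>, namely the supremum of
  \<open>\<Sum>\<^sub>D \<parallel>f \<chi>\<^sub>D\<parallel>\<^sup>p\<close> over finite disjoint families in \<open>B\<close> (\<open>superadditive_majorant\<close>).  As in the argument of
  Christ and Kiselev, the chain is cut at the first \<open>A\<^sub>k\<close> that carries at least a fraction \<open>s\<close> of the
  total \<open>\<phi>\<close>-mass \<open>V\<close>: the sets before \<open>A\<^sub>k\<close> have mass at most \<open>s V\<close>, the differences \<open>A\<^sub>j - A\<^sub>k\<close> after it
  have mass at most \<open>(1 - s) V\<close>, and both parts are cut again in the same way.  Following \<open>A\<^sub>j\<close> through
  this recursion, each cut at or before \<open>A\<^sub>j\<close> splits off one piece of it, so that \<open>A\<^sub>j\<close> becomes a disjoint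
  union of pieces.  Grouping the pieces by the number \<open>r\<close> of pieces split off earlier gives levels
  \<open>L\<^sub>r\<close> with
  \<open>\<Sum>\<^bsub>B \<in> L\<^sub>r\<^esub> \<phi>(B)\<^bsup>q/p\<^esup> \<le> K \<theta>\<^sup>r V\<^bsup>q/p\<^esup>\<close>, where \<open>K = 1 / (1 - s\<^bsup>q/p\<^esup>)\<close> and \<open>\<theta> = (1 - s)\<^bsup>q/p\<^esup> K\<close>
  (\<open>chain_decomposition\<close>).  The gain comes from \<open>q > p\<close>.

  By linearity \<open>T(f \<chi>\<^bsub>A\<^sub>j\<^esub>)\<close> is pointwise at most \<open>\<Sum>\<^sub>r max\<^bsub>B \<in> L\<^sub>r\<^esub> \<bar>T(f \<chi>\<^sub>B)\<bar>\<close> in modulus, for all \<open>j\<close> at once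
  (\<open>maximal_levels\<close>).  An upper \<open>q\<close>-estimate controls not only disjoint sums but every function that is
  pointwise dominated by one of finitely many others, since it can be cut into pieces each dominated by
  one of them (\<open>upper_estimate_dominated\<close>).  If \<open>F\<close> is a Banach space, each level is estimated in this way
  and the levels are added by the triangle inequality; the ratio of the resulting geometric series is
  \<open>\<theta>\<^bsup>1/q\<^esup>\<close> (\<open>additive_level_bound\<close>).  In the quasi-Banach case a sum \<open>\<Sum>\<^sub>r G\<^sub>r\<close> is at most one of the
  \<open>2\<^bsup>r+1\<^esup> G\<^sub>r\<close>, so a single application of the upper estimate to all weighted pieces takes the place of
  the triangle inequality (\<open>dyadic_level_bound\<close>).  With
  \<open>s = (1 + \<kappa>\<^bsup>-\<tau>\<^esup>)\<^bsup>-p/q\<^esup>\<close> (and \<open>\<kappa> = 1\<close> in the Banach case) the constants become the ones claimed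
  (\<open>splitting_ratio_constant\<close>, \<open>dyadic_weights_bound\<close>).  For \<open>q = \<infinity>\<close> the maximum is estimated directly.

  The bound does not depend on the number of sets, and the Fatou property extends it to a countable
  filtration.  The supremum could a priori be infinite on a set of positive measure; this is
  excluded by applying the Fatou property to truncations on that set (\<open>extended_qnorm_SUP_le\<close>).
\<close>

section \<open>Optimal constants\<close>

text \<open>
  For \<open>b x > 0\<close> the quotient \<open>a x / b x\<close> is a lower bound.  If \<open>b x = 0\<close>, finiteness of the infimum provides some
  finite admissible constant, which forces \<open>a x \<le> 0\<close>.
\<close>

lemma le_Inf_constant:
  fixes a b :: "'x \<Rightarrow> real"
  assumes fin: "Inf {C. \<forall>x. P x \<longrightarrow> ennreal (a x) \<le> C * ennreal (b x)} < \<infinity>" (is "Inf ?S < _")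
    and x: "P x" and b: "0 \<le> b x"
  shows "a x \<le> enn2real (Inf {C. \<forall>x. P x \<longrightarrow> ennreal (a x) \<le> C * ennreal (b x)}) * b x"
proof (cases "b x = 0")
  case True
  from fin have "?S \<noteq> {}" by (metis Inf_empty infinity_ennreal_def less_irrefl)
  then obtain C where "C \<in> ?S" by blast
  with x have "ennreal (a x) \<le> C * ennreal (b x)" by blast
  with True show ?thesis by (simp add: ennreal_eq_0_iff)
next
  case False
  with b have bpos: "0 < b x" by simp
  have "ennreal (a x / b x) \<le> C" if "C \<in> ?S" for C
  proof (cases C)
    case (real c)
    from that x have "ennreal (a x) \<le> C * ennreal (b x)" by blast
    then have "ennreal (a x) \<le> ennreal (c * b x)"
      using real b by (simp add: ennreal_mult)
    then have "a x \<le> c * b x"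
      using real b by (subst (asm) ennreal_le_iff) auto
    then show ?thesis using real bpos by (simp add: field_simps ennreal_leI)
  qed simp
  then have "ennreal (a x / b x) \<le> Inf ?S" by (rule Inf_greatest)
  also have "Inf ?S = ennreal (enn2real (Inf ?S))" using fin by simp
  finally have "a x / b x \<le> enn2real (Inf ?S)"
    by (subst (asm) ennreal_le_iff) auto
  then show ?thesis using bpos by (simp add: field_simps)
qed

lemma lp_sum_nonneg:
  assumes "\<And>j. j \<in> {1..n} \<Longrightarrow> 0 \<le> a j" "1 \<le> n"
  shows "0 \<le> lp_sum q n a"
proof -
  have "0 \<le> a n" using assms by simp
  also have "a n \<le> Max (a ` {1..n})" using assms(2) by (intro Max_ge imageI) auto
  finally show ?thesis by (simp add: lp_sum_def)
qed

lemma lp_sum_mono: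
  assumes "\<And>j. j \<in> {1..n} \<Longrightarrow> 0 \<le> a j" "\<And>j. j \<in> {1..n} \<Longrightarrow> a j \<le> b j" "1 \<le> n"
  shows "lp_sum q n a \<le> lp_sum q n b"
proof (cases "q = \<infinity>")
  case True
  have "Max (a ` {1..n}) \<le> Max (b ` {1..n})"
  proof (rule Max.boundedI)
    fix y assume "y \<in> a ` {1..n}"
    then obtain j where "j \<in> {1..n}" "y = a j" by auto
    with assms(2) show "y \<le> Max (b ` {1..n})"
      by (meson Max_ge finite_atLeastAtMost finite_imageI imageI order_trans)
  qed (use \<open>1 \<le> n\<close> in auto)
  then show ?thesis using True by (simp add: lp_sum_def)
next
  case False
  then show ?thesis unfolding lp_sum_def
    using assms by (auto intro!: powr_mono2 sum_mono sum_nonneg)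
qed

context quasi_normed_function_space
begin

lemma upper_const_bound:
  assumes fin: "upper_const E N M q < \<infinity>" and n: "1 \<le> n"
    and x: "\<And>j. j \<in> {1..n} \<Longrightarrow> x j \<in> E" "disjointly_supported M n x"
  shows "N (\<lambda>w. \<Sum>j=1..n. x j w) \<le> enn2real (upper_const E N M q) * lp_sum q n (\<lambda>j. N (x j))"
proof -
  have le: "upper_const_n E N M q n \<le> upper_const E N M q"
    unfolding upper_const_def using n by (intro SUP_upper) auto
  with fin have fin': "upper_const_n E N M q n < \<infinity>" by (rule le_less_trans[rotated])
  have nonneg: "0 \<le> lp_sum q n (\<lambda>j. N (x j))"
    using n x by (intro lp_sum_nonneg qnorm_nonneg) auto
  have "N (\<lambda>w. \<Sum>j=1..n. x j w)
      \<le> enn2real (upper_const_n E N M q n) * lp_sum q n (\<lambda>j. N (x j))"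
    unfolding upper_const_n_def
    by (rule le_Inf_constant) (use fin'[unfolded upper_const_n_def] x nonneg in auto)
  also have "\<dots> \<le> enn2real (upper_const E N M q) * lp_sum q n (\<lambda>j. N (x j))"
    using le fin nonneg by (intro mult_right_mono enn2real_mono) auto
  finally show ?thesis .
qed

lemma sum_mem:
  assumes "\<And>i. i \<in> I \<Longrightarrow> f i \<in> E"
  shows "(\<lambda>w. \<Sum>i\<in>I. f i w) \<in> E"
  using assms
proof (induction I rule: infinite_finite_induct)
  case (insert i I)
  then show ?case using add_mem[of "f i" "\<lambda>w. \<Sum>i\<in>I. f i w"] by simp
qed (use zero_mem in auto)

lemma lower_const_bound:
  assumes fin: "lower_const E N M q < \<infinity>" and n: "1 \<le> n"
    and x: "\<And>j. j \<in> {1..n} \<Longrightarrow> x j \<in> E" "disjointly_supported M n x"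
  shows "lp_sum q n (\<lambda>j. N (x j)) \<le> enn2real (lower_const E N M q) * N (\<lambda>w. \<Sum>j=1..n. x j w)"
proof -
  have le: "lower_const_n E N M q n \<le> lower_const E N M q"
    unfolding lower_const_def using n by (intro SUP_upper) auto
  with fin have fin': "lower_const_n E N M q n < \<infinity>" by (rule le_less_trans[rotated])
  have nonneg: "0 \<le> N (\<lambda>w. \<Sum>j=1..n. x j w)"
    using x by (intro sum_mem qnorm_nonneg) auto
  have "lp_sum q n (\<lambda>j. N (x j))
      \<le> enn2real (lower_const_n E N M q n) * N (\<lambda>w. \<Sum>j=1..n. x j w)"
    unfolding lower_const_n_def
    by (rule le_Inf_constant[where b = "\<lambda>x. N (\<lambda>w. \<Sum>j=1..n. x j w)"])
       (use fin'[unfolded lower_const_n_def] x nonneg in auto)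
  also have "\<dots> \<le> enn2real (lower_const E N M q) * N (\<lambda>w. \<Sum>j=1..n. x j w)"
    using le fin nonneg by (intro mult_right_mono enn2real_mono) auto
  finally show ?thesis .
qed

end

lemma operator_norm_bound:
  assumes T: "bounded_linear_operator E NE M F NF M' T" and f: "f \<in> E"
    and nonneg: "\<And>f. f \<in> E \<Longrightarrow> 0 \<le> NE f"
  shows "operator_norm E NE NF T < \<infinity>" "NF (T f) \<le> enn2real (operator_norm E NE NF T) * NE f"
proof -
  from T obtain C where C: "\<forall>f\<in>E. NF (T f) \<le> C * NE f"
    unfolding bounded_linear_operator_def by blast
  have "operator_norm E NE NF T \<le> ennreal (max C 0)"
    unfolding operator_norm_def
  proof (rule Inf_lower, safe)
    fix f assume f: "f \<in> E"
    have "NF (T f) \<le> C * NE f" using C f by blast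
    also have "\<dots> \<le> max C 0 * NE f" using nonneg[OF f] by (intro mult_right_mono) auto
    finally show "ennreal (NF (T f)) \<le> ennreal (max C 0) * ennreal (NE f)"
      using nonneg[OF f] by (simp add: ennreal_mult[symmetric] ennreal_leI)
  qed
  then show fin: "operator_norm E NE NF T < \<infinity>"
    using ennreal_less_top le_less_trans by fastforce
  show "NF (T f) \<le> enn2real (operator_norm E NE NF T) * NE f"
    using fin unfolding operator_norm_def Ball_def
    by (intro le_Inf_constant) (use f nonneg in auto)
qed


section \<open>Upper estimates and pointwise domination\<close>

context quasi_banach_function_lattice
begin

lemma restrict_mem:
  assumes "f \<in> E" "B \<in> sets M"
  shows "(\<lambda>w. f w * indicator B w) \<in> E" "N (\<lambda>w. f w * indicator B w) \<le> N f"
proof -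
  have [measurable]: "f \<in> borel_measurable M" using assms subset_L0 by auto
  have "(\<lambda>w. f w * indicator B w) \<in> borel_measurable M" using assms(2) by measurable
  with ideal[OF assms(1) this]
  show "(\<lambda>w. f w * indicator B w) \<in> E" "N (\<lambda>w. f w * indicator B w) \<le> N f"
    by (auto simp: indicator_def)
qed

lemma AE_equal_mem:
  assumes "f \<in> E" "g \<in> borel_measurable M" "AE w in M. g w = f w"
  shows "g \<in> E" "N g = N f"
proof -
  have 1: "g \<in> E \<and> N g \<le> N f" by (rule ideal[OF assms(1,2)]) (use assms(3) in auto)
  have 2: "f \<in> E \<and> N f \<le> N g"
    by (rule ideal) (use 1 assms subset_L0 in auto)
  from 1 2 show "g \<in> E" "N g = N f" by auto
qed

text \<open>
  Cut \<open>g\<close> along the sets where \<open>h\<^sub>j\<close> is the first of the functions that dominates it.  The pieces are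
  disjointly supported, so the upper estimate applies to them although the \<open>h\<^sub>j\<close> may overlap.
\<close>

lemma upper_estimate_dominated:
  assumes fin: "upper_const E N M q < \<infinity>" and n: "1 \<le> n"
    and h: "\<And>j. j \<in> {1..n} \<Longrightarrow> h j \<in> E"
    and g[measurable]: "g \<in> borel_measurable M"
    and dom: "AE w in M. \<exists>j\<in>{1..n}. norm (g w) \<le> norm (h j w)"
  shows "g \<in> E" "N g \<le> enn2real (upper_const E N M q) * lp_sum q n (\<lambda>j. N (h j))"
proof -
  define S where "S j = {w \<in> space M. norm (g w) \<le> norm (h j w)}" for j
  define D where "D j = S j - (\<Union>i\<in>{1..<j}. S i)" for j
  define x where "x j w = g w * indicator (D j) w" for j w
  have hm: "h j \<in> borel_measurable M" if "j \<in> {1..n}" for j using h that subset_L0 by auto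
  have S[measurable]: "S j \<in> sets M" if "j \<in> {1..n}" for j
    unfolding S_def using hm[OF that] by measurable
  have D: "D j \<in> sets M" if "j \<in> {1..n}" for j
    unfolding D_def using that by (intro sets.Diff sets.finite_UN S) auto
  have x: "x j \<in> E \<and> N (x j) \<le> N (h j)" if j: "j \<in> {1..n}" for j
  proof (rule ideal[OF h[OF j]])
    show "x j \<in> borel_measurable M" unfolding x_def using D[OF j] by measurable
    show "AE w in M. norm (x j w) \<le> norm (h j w)"
      by (auto simp: x_def D_def S_def indicator_def)
  qed
  have disj_D: "w \<notin> D j" if "w \<in> D i" "i \<in> {1..n}" "j \<in> {1..n}" "i \<noteq> j" for w i j
    using that unfolding D_def by (cases "i < j") auto
  have disj: "disjointly_supported M n x"
    unfolding disjointly_supported_def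
  proof (intro ballI impI AE_I2)
    fix i j w assume "i \<in> {1..n}" "j \<in> {1..n}" "i \<noteq> j"
    then show "x i w = 0 \<or> x j w = 0"
      using disj_D[of w i j] by (auto simp: x_def indicator_def)
  qed
  have sum_eq: "AE w in M. g w = (\<Sum>j=1..n. x j w)"
    using dom AE_space
  proof eventually_elim
    case (elim w)
    define k where "k = (LEAST j. j \<in> {1..n} \<and> w \<in> S j)"
    from elim have ex: "\<exists>j. j \<in> {1..n} \<and> w \<in> S j" unfolding S_def by auto
    have k: "k \<in> {1..n} \<and> w \<in> S k" unfolding k_def by (rule LeastI_ex[OF ex])
    have kD: "w \<in> D k"
      unfolding D_def
    proof (intro DiffI notI)
      show "w \<in> S k" using k by blast
      assume "w \<in> (\<Union>i\<in>{1..<k}. S i)"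
      then obtain i where "i \<in> {1..<k}" "w \<in> S i" by auto
      then have "k \<le> i" unfolding k_def using k by (intro Least_le) (auto simp: k_def)
      with \<open>i \<in> {1..<k}\<close> show False by auto
    qed
    have "(\<Sum>j=1..n. x j w) = (\<Sum>j\<in>{1..n}. if j = k then g w else 0)"
      using kD disj_D[OF kD] k by (intro sum.cong refl) (auto simp: x_def indicator_def)
    then show ?case using k by auto
  qed
  note 1 = AE_equal_mem[OF sum_mem[of "{1..n}" x] g sum_eq]
  show "g \<in> E" using 1(1) x by blast
  have "N g = N (\<lambda>w. \<Sum>j=1..n. x j w)" using 1(2) x by blast
  also have "\<dots> \<le> enn2real (upper_const E N M q) * lp_sum q n (\<lambda>j. N (x j))"
    by (rule upper_const_bound[OF fin n _ disj]) (use x in auto)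
  also have "\<dots> \<le> enn2real (upper_const E N M q) * lp_sum q n (\<lambda>j. N (h j))"
    using x n by (intro mult_left_mono lp_sum_mono qnorm_nonneg) auto
  finally show "N g \<le> enn2real (upper_const E N M q) * lp_sum q n (\<lambda>j. N (h j))" .
qed

lemma upper_estimate_dominated_sum:
  fixes q :: real
  assumes fin: "upper_const E N M (ennreal q) < \<infinity>" and q: "0 < q"
    and I: "finite I" "I \<noteq> {}" and h: "\<And>i. i \<in> I \<Longrightarrow> h i \<in> E"
    and g: "g \<in> borel_measurable M" and dom: "AE w in M. \<exists>i\<in>I. norm (g w) \<le> norm (h i w)"
  shows "g \<in> E"
    "N g \<le> enn2real (upper_const E N M (ennreal q)) * (\<Sum>i\<in>I. N (h i) powr q) powr (1 / q)"
proof -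
  obtain e where e: "bij_betw e {1..card I} I" using ex_bij_betw_nat_finite_1[OF I(1)] by blast
  have n: "1 \<le> card I" using I by (simp add: Suc_leI card_gt_0_iff)
  have he: "h (e j) \<in> E" if "j \<in> {1..card I}" for j
    using h bij_betwE[OF e] that by blast
  have dom': "AE w in M. \<exists>j\<in>{1..card I}. norm (g w) \<le> norm (h (e j) w)"
    using dom
  proof eventually_elim
    case (elim w)
    then obtain i where i: "i \<in> I" "norm (g w) \<le> norm (h i w)" by blast
    from i(1) have "i \<in> e ` {1..card I}" unfolding bij_betw_imp_surj_on[OF e] .
    then obtain j where "i = e j" "j \<in> {1..card I}" by (rule imageE)
    then show ?case using i(2) by (intro bexI[of _ j]) simp_all
  qed
  note * = upper_estimate_dominated[where h = "\<lambda>j. h (e j)", OF fin n he g dom']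
  show "g \<in> E" by (rule *(1))
  have "lp_sum (ennreal q) (card I) (\<lambda>j. N (h (e j))) = (\<Sum>i\<in>I. N (h i) powr q) powr (1 / q)"
    using q sum.reindex_bij_betw[OF e, of "\<lambda>i. N (h i) powr q"] by (simp add: lp_sum_def)
  with *(2) show
    "N g \<le> enn2real (upper_const E N M (ennreal q)) * (\<Sum>i\<in>I. N (h i) powr q) powr (1 / q)"
    by simp
qed

lemma upper_estimate_dominated_infinity:
  assumes fin: "upper_const E N M \<infinity> < \<infinity>"
    and I: "finite I" "I \<noteq> {}" and h: "\<And>i. i \<in> I \<Longrightarrow> h i \<in> E" "\<And>i. i \<in> I \<Longrightarrow> N (h i) \<le> c"
    and g: "g \<in> borel_measurable M" and dom: "AE w in M. \<exists>i\<in>I. norm (g w) \<le> norm (h i w)"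
  shows "g \<in> E" "N g \<le> enn2real (upper_const E N M \<infinity>) * c"
proof -
  obtain e where e: "bij_betw e {1..card I} I" using ex_bij_betw_nat_finite_1[OF I(1)] by blast
  have n: "1 \<le> card I" using I by (simp add: Suc_leI card_gt_0_iff)
  have he: "h (e j) \<in> E" "N (h (e j)) \<le> c" if "j \<in> {1..card I}" for j
    using h bij_betwE[OF e] that by blast+
  have dom': "AE w in M. \<exists>j\<in>{1..card I}. norm (g w) \<le> norm (h (e j) w)"
    using dom
  proof eventually_elim
    case (elim w)
    then obtain i where i: "i \<in> I" "norm (g w) \<le> norm (h i w)" by blast
    from i(1) have "i \<in> e ` {1..card I}" unfolding bij_betw_imp_surj_on[OF e] .
    then obtain j where "i = e j" "j \<in> {1..card I}" by (rule imageE)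
    then show ?case using i(2) by (intro bexI[of _ j]) simp_all
  qed
  note * = upper_estimate_dominated[where h = "\<lambda>j. h (e j)", OF fin n he(1) g dom']
  show "g \<in> E" by (rule *(1))
  have "lp_sum \<infinity> (card I) (\<lambda>j. N (h (e j))) \<le> c"
    unfolding lp_sum_def using n he(2) by (auto simp: Max_le_iff)
  with *(2) show "N g \<le> enn2real (upper_const E N M \<infinity>) * c"
    by (meson enn2real_nonneg mult_left_mono order_trans)
qed

end

section \<open>Splitting a chain of sets\<close>

text \<open>
  One piece is taken from each level; the empty set stands for a level that contributes nothing.
\<close>

definition union_of_levels :: "nat \<Rightarrow> (nat \<Rightarrow> 'a set set) \<Rightarrow> 'a set \<Rightarrow> bool" where
  "union_of_levels n L S \<longleftrightarrow>
     (\<exists>b. (\<forall>r<n. b r \<in> insert {} (L r)) \<and> disjoint_family_on b {..<n} \<and> S = (\<Union>r<n. b r))"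

text \<open>
  Induction on the bound \<open>n\<close> for the number of sets.  With \<open>A\<^sub>k\<close> the first set of mass at least \<open>s V\<close>, the
  levels \<open>L1\<close> of the sets before \<open>A\<^sub>k\<close> are kept, \<open>A\<^sub>k\<close> joins level 0, and the levels \<open>L2\<close> of the differences
  \<open>A\<^sub>j - A\<^sub>k\<close> are shifted up by one, as these are added to \<open>A\<^sub>k\<close>.  The constants are determined by the two
  recursions \<open>K s\<^bsup>\<sigma>\<^esup> + 1 = K\<close> (level 0) and \<open>K \<theta> s\<^bsup>\<sigma>\<^esup> + K (1 - s)\<^bsup>\<sigma>\<^esup> = K \<theta>\<close> (the others).
\<close>

lemma chain_decomposition:
  fixes A :: "'i::linorder \<Rightarrow> 'a set" and \<phi> :: "'a set \<Rightarrow> real"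
  assumes nonneg: "\<And>B. B \<in> sets M \<Longrightarrow> 0 \<le> \<phi> B"
    and super: "\<And>B C. B \<in> sets M \<Longrightarrow> C \<in> sets M \<Longrightarrow> B \<inter> C = {} \<Longrightarrow> \<phi> B + \<phi> C \<le> \<phi> (B \<union> C)"
    and s: "0 < s" "s < 1" and \<sigma>: "0 < \<sigma>"
    and K: "K = 1 / (1 - s powr \<sigma>)" and \<theta>: "\<theta> = (1 - s) powr \<sigma> * K"
  assumes "finite J" "card J \<le> n" "\<And>j. j \<in> J \<Longrightarrow> A j \<in> sets M"
    "\<And>i j. i \<in> J \<Longrightarrow> j \<in> J \<Longrightarrow> i < j \<Longrightarrow> A i \<subseteq> A j"
    "\<And>j. j \<in> J \<Longrightarrow> \<phi> (A j) \<le> U" "0 \<le> U"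
  shows "\<exists>L. (\<forall>r. finite (L r) \<and> L r \<subseteq> sets M \<and>
                (\<Sum>B\<in>L r. \<phi> B powr \<sigma>) \<le> K * \<theta> ^ r * U powr \<sigma>) \<and>
             (\<forall>j\<in>J. union_of_levels n L (A j))"
  using assms(8-)
proof (induction n arbitrary: J A U)
  case 0
  have "0 < 1 - s powr \<sigma>"
    using s \<sigma> powr_less_mono2[of \<sigma> s 1] by simp
  then have "0 \<le> K" "0 \<le> \<theta>" using s by (simp_all add: K \<theta>)
  then show ?case using 0 by (intro exI[of _ "\<lambda>r. {}"]) auto
next
  case (Suc n)
  have s\<sigma>: "0 < 1 - s powr \<sigma>"
    using s \<sigma> powr_less_mono2[of \<sigma> s 1] by simp
  then have K1: "1 \<le> K" unfolding K using s by (simp add: field_simps)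
  then have \<theta>0: "0 \<le> \<theta>" using s by (simp add: \<theta>)
  have K_eq: "K * s powr \<sigma> + 1 = K" unfolding K using s\<sigma> by (simp add: field_simps)
  show ?case
  proof (cases "J = {}")
    case True
    then show ?thesis using K1 \<theta>0 by (intro exI[of _ "\<lambda>r. {}"]) auto
  next
    case False
    define V where "V = \<phi> (A (Max J))"
    have MaxJ: "Max J \<in> J" using False Suc.prems(1) by simp
    have V0: "0 \<le> V" unfolding V_def using nonneg Suc.prems(3) MaxJ by blast
    have VU: "V \<le> U" unfolding V_def using Suc.prems(5) MaxJ by blast
    have diff: "\<phi> (C - B) \<le> \<phi> C - \<phi> B" if "B \<in> sets M" "C \<in> sets M" "B \<subseteq> C" for B C
      using super[of B "C - B"] that by (simp add: Un_absorb1 Diff_partition sets.Diff)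
    have mono: "\<phi> B \<le> \<phi> C" if "B \<in> sets M" "C \<in> sets M" "B \<subseteq> C" for B C
      using diff[OF that] nonneg[of "C - B"] that by auto
    have chain: "A i \<subseteq> A j" if "i \<in> J" "j \<in> J" "i \<le> j" for i j
      using Suc.prems(4)[of i j] that by (cases "i = j") auto
    have \<phi>V: "\<phi> (A j) \<le> V" if "j \<in> J" for j
      unfolding V_def using that MaxJ Suc.prems by (intro mono chain) auto
    \<comment> \<open>Admitting equality keeps \<open>X\<close> nonempty when \<open>V = 0\<close>.\<close>
    define X where "X = {j \<in> J. s * V \<le> \<phi> (A j)}"
    have "s * V \<le> 1 * V" using s V0 by (intro mult_right_mono) auto
    then have X: "finite X" "X \<noteq> {}"
      unfolding X_def using Suc.prems(1) MaxJ by (auto simp: V_def)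
    define k where "k = Min X"
    have kX: "k \<in> X" unfolding k_def using X by simp
    then have k: "k \<in> J" "s * V \<le> \<phi> (A k)" unfolding X_def by auto
    have less_k: "\<phi> (A j) \<le> s * V" if "j \<in> J" "j < k" for j
    proof (rule ccontr)
      assume "\<not> ?thesis"
      then have "j \<in> X" using that by (auto simp: X_def)
      then have "k \<le> j" unfolding k_def using X by simp
      with that show False by auto
    qed
    define J1 where "J1 = {j \<in> J. j < k}"
    define J2 where "J2 = {j \<in> J. k < j}"
    have "card J1 < card J" "card J2 < card J"
      unfolding J1_def J2_def using k Suc.prems(1) by (auto intro!: psubset_card_mono)
    then have card: "card J1 \<le> n" "card J2 \<le> n" using Suc.prems(2) by auto
    have "\<exists>L. (\<forall>r. finite (L r) \<and> L r \<subseteq> sets M \<and>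
                (\<Sum>B\<in>L r. \<phi> B powr \<sigma>) \<le> K * \<theta> ^ r * (s * V) powr \<sigma>) \<and>
             (\<forall>j\<in>J1. union_of_levels n L (A j))"
      by (rule Suc.IH) (use card Suc.prems less_k s V0 in \<open>auto simp: J1_def\<close>)
    then obtain L1 where
      "\<forall>r. finite (L1 r) \<and> L1 r \<subseteq> sets M \<and>
        (\<Sum>B\<in>L1 r. \<phi> B powr \<sigma>) \<le> K * \<theta> ^ r * (s * V) powr \<sigma>"
      "\<forall>j\<in>J1. union_of_levels n L1 (A j)"
      by (elim exE conjE) (rule that)
    then have L1: "\<And>r. finite (L1 r)" "\<And>r. L1 r \<subseteq> sets M"
      "\<And>r. (\<Sum>B\<in>L1 r. \<phi> B powr \<sigma>) \<le> K * \<theta> ^ r * (s * V) powr \<sigma>"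
      "\<And>j. j \<in> J1 \<Longrightarrow> union_of_levels n L1 (A j)"
      by auto
    have "\<exists>L. (\<forall>r. finite (L r) \<and> L r \<subseteq> sets M \<and>
                (\<Sum>B\<in>L r. \<phi> B powr \<sigma>) \<le> K * \<theta> ^ r * ((1 - s) * V) powr \<sigma>) \<and>
             (\<forall>j\<in>J2. union_of_levels n L (A j - A k))"
    proof (rule Suc.IH)
      fix j assume "j \<in> J2"
      then have j: "j \<in> J" "k < j" by (auto simp: J2_def)
      have "\<phi> (A j - A k) \<le> \<phi> (A j) - \<phi> (A k)"
        using j k Suc.prems by (intro diff) auto
      also have "\<dots> \<le> V - s * V" using \<phi>V[OF j(1)] k by auto
      finally show "\<phi> (A j - A k) \<le> (1 - s) * V" by (simp add: algebra_simps)
    next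
      fix i j assume "i \<in> J2" "j \<in> J2" "i < j"
      then show "A i - A k \<subseteq> A j - A k" using Suc.prems(4)[of i j] by (auto simp: J2_def)
    qed (use card Suc.prems k s V0 in \<open>auto simp: J2_def\<close>)
    then obtain L2 where
      "\<forall>r. finite (L2 r) \<and> L2 r \<subseteq> sets M \<and>
        (\<Sum>B\<in>L2 r. \<phi> B powr \<sigma>) \<le> K * \<theta> ^ r * ((1 - s) * V) powr \<sigma>"
      "\<forall>j\<in>J2. union_of_levels n L2 (A j - A k)"
      by (elim exE conjE) (rule that)
    then have L2: "\<And>r. finite (L2 r)" "\<And>r. L2 r \<subseteq> sets M"
      "\<And>r. (\<Sum>B\<in>L2 r. \<phi> B powr \<sigma>) \<le> K * \<theta> ^ r * ((1 - s) * V) powr \<sigma>"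
      "\<And>j. j \<in> J2 \<Longrightarrow> union_of_levels n L2 (A j - A k)"
      by auto
    define L where "L r = (case r of 0 \<Rightarrow> insert (A k) (L1 0) | Suc r \<Rightarrow> L1 (Suc r) \<union> L2 r)" for r
    have L_simps: "L 0 = insert (A k) (L1 0)" "L (Suc r) = L1 (Suc r) \<union> L2 r" for r
      by (simp_all add: L_def)
    have V\<sigma>: "V powr \<sigma> \<le> U powr \<sigma>" using V0 VU \<sigma> by (intro powr_mono2) auto
    have V_powr: "(s * V) powr \<sigma> = s powr \<sigma> * V powr \<sigma>"
      "((1 - s) * V) powr \<sigma> = (1 - s) powr \<sigma> * V powr \<sigma>"
      using s V0 by (simp_all add: powr_mult)
    have sumV: "(\<Sum>B\<in>L r. \<phi> B powr \<sigma>) \<le> K * \<theta> ^ r * V powr \<sigma>" for r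
    proof (cases r)
      case 0
      have "(\<Sum>B\<in>L r. \<phi> B powr \<sigma>) \<le> \<phi> (A k) powr \<sigma> + (\<Sum>B\<in>L1 0. \<phi> B powr \<sigma>)"
        unfolding 0 L_simps using L1(1)[of 0] by (simp add: sum.insert_if)
      also have "\<dots> \<le> V powr \<sigma> + K * (s powr \<sigma> * V powr \<sigma>)"
        using L1(3)[of 0] \<phi>V[OF k(1)] nonneg[of "A k"] Suc.prems(3)[OF k(1)] \<sigma>
        by (intro add_mono powr_mono2) (auto simp: V_powr)
      also have "\<dots> = (K * s powr \<sigma> + 1) * V powr \<sigma>" by (simp add: algebra_simps)
      finally show ?thesis unfolding K_eq 0 by simp
    next
      case (Suc r')
      have "(\<Sum>B\<in>L r. \<phi> B powr \<sigma>) \<le> (\<Sum>B\<in>L1 r. \<phi> B powr \<sigma>) + (\<Sum>B\<in>L2 r'. \<phi> B powr \<sigma>)"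
        unfolding Suc L_simps
        by (subst sum.union_inter[symmetric]) (use L1(1) L2(1) in \<open>auto intro!: sum_nonneg\<close>)
      also have "\<dots> \<le> K * \<theta> ^ r * (s powr \<sigma> * V powr \<sigma>)
          + K * \<theta> ^ r' * ((1 - s) powr \<sigma> * V powr \<sigma>)"
        using L1(3)[of r] L2(3)[of r'] unfolding V_powr by (rule add_mono)
      also have "\<dots> = K * s powr \<sigma> * (\<theta> ^ r * V powr \<sigma>)
          + \<theta> ^ r' * ((1 - s) powr \<sigma> * K) * V powr \<sigma>"
        by (simp add: algebra_simps)
      also have "\<dots> = (K * s powr \<sigma> + 1) * (\<theta> ^ r * V powr \<sigma>)"
        unfolding \<theta>[symmetric] Suc by (simp add: algebra_simps)
      finally show ?thesis unfolding K_eq by simp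
    qed
    have sumU: "(\<Sum>B\<in>L r. \<phi> B powr \<sigma>) \<le> K * \<theta> ^ r * U powr \<sigma>" for r
      by (rule order_trans[OF sumV]) (use V\<sigma> K1 \<theta>0 in \<open>auto intro!: mult_left_mono\<close>)
    have fin: "finite (L r) \<and> L r \<subseteq> sets M" for r
      using L1(1,2) L2(1,2) k Suc.prems(3) by (cases r) (auto simp: L_simps)
    have pieces: "union_of_levels (Suc n) L (A j)" if j: "j \<in> J" for j
    proof -
      consider "j < k" | "j = k" | "k < j" by fastforce
      then show ?thesis
      proof cases
        case 1
        then have "j \<in> J1" using j by (simp add: J1_def)
        from L1(4)[OF this, unfolded union_of_levels_def] obtain b where b: "\<forall>r<n. b r \<in> insert {} (L1 r)"
          "disjoint_family_on b {..<n}" "A j = (\<Union>r<n. b r)" by blast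
        have "L1 r \<subseteq> L r" for r by (cases r) (auto simp: L_simps)
        then have "(b(n := {})) r \<in> insert {} (L r)" if "r < Suc n" for r
          using b(1) that by (cases "r = n") (auto simp: less_Suc_eq)
        moreover have "disjoint_family_on (b(n := {})) {..<Suc n}"
          using b(2) by (auto simp: disjoint_family_on_def)
        moreover have "A j = (\<Union>r<Suc n. (b(n := {})) r)" unfolding b(3) lessThan_Suc by auto
        ultimately show ?thesis unfolding union_of_levels_def by blast
      next
        case 2
        show ?thesis unfolding 2 union_of_levels_def
          by (intro exI[of _ "\<lambda>r. if r = 0 then A k else {}"])
             (auto simp: disjoint_family_on_def L_simps)
      next
        case 3
        then have "j \<in> J2" using j by (simp add: J2_def)
        from L2(4)[OF this, unfolded union_of_levels_def] obtain b where b: "\<forall>r<n. b r \<in> insert {} (L2 r)"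
          "disjoint_family_on b {..<n}" "A j - A k = (\<Union>r<n. b r)" by blast
        define b' where "b' r = (case r of 0 \<Rightarrow> A k | Suc r \<Rightarrow> b r)" for r
        have b'_simps: "b' 0 = A k" "b' (Suc r) = b r" for r by (simp_all add: b'_def)
        have "A k \<subseteq> A j" using k j 3 by (intro chain) auto
        then have "A j = A k \<union> (A j - A k)" by auto
        also have "\<dots> = (\<Union>r<Suc n. b' r)" unfolding b(3)
          by (simp add: lessThan_Suc_eq_insert_0 b'_simps)
        finally have "A j = (\<Union>r<Suc n. b' r)" .
        moreover have "b' r \<in> insert {} (L r)" if "r < Suc n" for r
          using b(1) that by (cases r) (auto simp: b'_simps L_simps)
        moreover have "disjoint_family_on b' {..<Suc n}"
          unfolding disjoint_family_on_def
        proof (intro ballI impI)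
          fix r r' assume r: "r \<in> {..<Suc n}" "r' \<in> {..<Suc n}" "r \<noteq> r'"
          have *: "A k \<inter> b i = {}" if "i < n" for i using b(3) that by blast
          show "b' r \<inter> b' r' = {}"
            using r * b(2) by (cases r; cases r') (auto simp: b'_simps disjoint_family_on_def)
        qed
        ultimately show ?thesis unfolding union_of_levels_def by blast
      qed
    qed
    show ?thesis using fin sumU pieces by (intro exI[of _ L] conjI) auto
  qed
qed

section \<open>The superadditive set function of a lower estimate\<close>

context quasi_banach_function_lattice
begin

lemma qnorm_zero: "N (\<lambda>w. 0) = 0"
  by (rule qnorm_eq_0_iff[OF zero_mem, THEN iffD2]) simp

lemma lower_estimate_family:
  fixes p :: real
  assumes fin: "lower_const E N M (ennreal p) < \<infinity>" and p: "0 < p" and f: "f \<in> E"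
    and P: "finite P" "P \<subseteq> sets M" "disjoint P"
  shows "(\<Sum>D\<in>P. N (\<lambda>w. f w * indicator D w) powr p)
    \<le> (enn2real (lower_const E N M (ennreal p)) * N f) powr p"
proof (cases "P = {}")
  case False
  let ?l = "enn2real (lower_const E N M (ennreal p))"
  obtain e where e: "bij_betw e {1..card P} P" using ex_bij_betw_nat_finite_1[OF P(1)] by blast
  have n: "1 \<le> card P" using P False by (simp add: Suc_leI card_gt_0_iff)
  define x where "x j w = f w * indicator (e j) w" for j w
  have eP: "e j \<in> P" if "j \<in> {1..card P}" for j using bij_betwE[OF e] that by blast
  have x: "x j \<in> E" if "j \<in> {1..card P}" for j
    unfolding x_def using eP[OF that] P f by (intro restrict_mem) auto
  have disj: "e i \<inter> e j = {}" if "i \<in> {1..card P}" "j \<in> {1..card P}" "i \<noteq> j" for i j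
  proof -
    have "e i \<noteq> e j" 
      using inj_on_eq_iff[OF bij_betw_imp_inj_on[OF e] that(1,2)] that(3) by blast
    then show ?thesis by (rule disjointD[OF P(3) eP[OF that(1)] eP[OF that(2)]])
  qed
  have ds: "disjointly_supported M (card P) x"
    unfolding disjointly_supported_def x_def
  proof (intro ballI impI AE_I2)
    fix i j w assume "i \<in> {1..card P}" "j \<in> {1..card P}" "i \<noteq> j"
    from disj[OF this] show "f w * indicator (e i) w = 0 \<or> f w * indicator (e j) w = 0"
      by (auto simp: indicator_def)
  qed
  have sum: "(\<Sum>j=1..card P. x j w) = f w * indicator (\<Union>P) w" for w
  proof -
    have ind: "(indicator (\<Union>P) w :: 'b) = (\<Sum>D\<in>P. indicator D w)"
      using indicator_UN_disjoint[OF P(1), of "\<lambda>D. D" w] P(3)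
      by (simp add: disjoint_family_on_def disjoint_def)
    have "(\<Sum>j=1..card P. x j w) = (\<Sum>D\<in>P. f w * indicator D w)"
      unfolding x_def by (rule sum.reindex_bij_betw[OF e])
    also have "\<dots> = f w * indicator (\<Union>P) w"
      by (simp add: ind sum_distrib_left)
    finally show ?thesis .
  qed
  have "(\<Sum>D\<in>P. N (\<lambda>w. f w * indicator D w) powr p) powr (1 / p)
      = lp_sum (ennreal p) (card P) (\<lambda>j. N (x j))"
    using p sum.reindex_bij_betw[OF e, of "\<lambda>D. N (\<lambda>w. f w * indicator D w) powr p"]
    by (simp add: lp_sum_def x_def[abs_def])
  also have "\<dots> \<le> ?l * N (\<lambda>w. \<Sum>j=1..card P. x j w)"
    by (rule lower_const_bound[OF fin n x ds])
  also have "\<dots> \<le> ?l * N f"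
    unfolding sum using P f by (intro mult_left_mono restrict_mem) auto
  finally have "((\<Sum>D\<in>P. N (\<lambda>w. f w * indicator D w) powr p) powr (1 / p)) powr p \<le> (?l * N f) powr p"
    using p by (intro powr_mono2) auto
  then show ?thesis using p by (simp add: powr_powr sum_nonneg)
qed auto

text \<open>
  The supremum over finite disjoint families is superadditive because families in disjoint sets can be
  joined, and the lower estimate bounds it from above.
\<close>

lemma superadditive_majorant:
  fixes p :: real
  assumes fin: "lower_const E N M (ennreal p) < \<infinity>" and p: "0 < p" and f: "f \<in> E"
  obtains \<phi> :: "'a set \<Rightarrow> real" where
    "\<And>B. B \<in> sets M \<Longrightarrow> 0 \<le> \<phi> B"
    "\<And>B C. B \<in> sets M \<Longrightarrow> C \<in> sets M \<Longrightarrow> B \<inter> C = {} \<Longrightarrow> \<phi> B + \<phi> C \<le> \<phi> (B \<union> C)"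
    "\<And>B. B \<in> sets M \<Longrightarrow> N (\<lambda>w. f w * indicator B w) powr p \<le> \<phi> B"
    "\<And>B. B \<in> sets M \<Longrightarrow> \<phi> B \<le> (enn2real (lower_const E N M (ennreal p)) * N f) powr p"
proof -
  define S where "S P = (\<Sum>D\<in>P. N (\<lambda>w. f w * indicator D w) powr p)" for P
  define F where "F B = {P. finite P \<and> P \<subseteq> sets M \<and> disjoint P \<and> \<Union>P \<subseteq> B}" for B
  define \<phi> where "\<phi> B = (SUP P\<in>F B. S P)" for B
  let ?b = "(enn2real (lower_const E N M (ennreal p)) * N f) powr p"
  have S_le: "S P \<le> ?b" if "P \<in> F B" for P B
    using lower_estimate_family[OF fin p f] that by (auto simp: S_def F_def)
  have bdd: "bdd_above (S ` F B)" for B using S_le by (intro bdd_aboveI2)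
  have ne: "{} \<in> F B" for B by (auto simp: F_def)
  have upper: "S P \<le> \<phi> B" if "P \<in> F B" for P B
    unfolding \<phi>_def by (rule cSUP_upper[OF that bdd])
  have le: "\<phi> B \<le> c" if "\<And>P. P \<in> F B \<Longrightarrow> S P \<le> c" for B c
    unfolding \<phi>_def using that ne by (intro cSUP_least) auto
  show ?thesis
  proof (rule that)
    fix B assume B: "B \<in> sets M"
    show "0 \<le> \<phi> B" using upper[OF ne, of B] by (simp add: S_def)
    show "N (\<lambda>w. f w * indicator B w) powr p \<le> \<phi> B"
      using upper[of "{B}" B] B by (simp add: S_def F_def)
    show "\<phi> B \<le> ?b" using S_le by (rule le)
  next
    fix B C :: "'a set" assume BC: "B \<inter> C = {}"
    have *: "S P + S P' \<le> \<phi> (B \<union> C)" if P: "P \<in> F B" "P' \<in> F C" for P P'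
    proof -
      \<comment> \<open>The two families can share only the empty set, which contributes nothing to the sums.\<close>
      have "\<Union>P \<subseteq> B" "\<Union>P' \<subseteq> C" using P by (simp_all add: F_def)
      have disj: "\<Union>P \<inter> \<Union>P' = {}" 
        using BC \<open>\<Union>P \<subseteq> B\<close> \<open>\<Union>P' \<subseteq> C\<close> by blast
      then have "P \<inter> P' \<subseteq> {{}}" by blast
      then have "S (P \<inter> P') = 0" unfolding S_def by (intro sum.neutral) (auto simp: qnorm_zero)
      moreover have "S (P \<union> P') + S (P \<inter> P') = S P + S P'"
        unfolding S_def using P by (intro sum.union_inter) (auto simp: F_def)
      moreover have "P \<union> P' \<in> F (B \<union> C)"
        using P disj disjoint_union[of P P'] unfolding F_def
        by (simp add: le_supI1 le_supI2)
      ultimately show ?thesis using upper[of "P \<union> P'" "B \<union> C"] by linarith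
    qed
    have "S P \<le> \<phi> (B \<union> C) - \<phi> C" if P: "P \<in> F B" for P
    proof -
      have "\<phi> C \<le> \<phi> (B \<union> C) - S P" using *[OF P] by (intro le) (simp add: algebra_simps)
      then show ?thesis by simp
    qed
    then have "\<phi> B \<le> \<phi> (B \<union> C) - \<phi> C" by (rule le)
    then show "\<phi> B + \<phi> C \<le> \<phi> (B \<union> C)" by simp
  qed
qed

section \<open>Monotone limits\<close>

text \<open>
  On the set \<open>S\<close> where the supremum is infinite, the truncations \<open>min g\<^sub>j m \<cdot> \<chi>\<^sub>S\<close> increase to \<open>m \<chi>\<^sub>S\<close>.
  Hence \<open>m \<parallel>\<chi>\<^sub>S\<parallel> \<le> c\<close> for all \<open>m\<close>, so \<open>S\<close> is a null set, and the Fatou property can be applied to the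
  now finite limit.
\<close>

lemma extended_qnorm_SUP_le:
  assumes fatou: "fatou_property E N M"
    and g: "\<And>j. (\<lambda>w. of_real (g j w)) \<in> E" "\<And>j w. 0 \<le> g j w" "\<And>j w. g j w \<le> g (Suc j) w"
    and c: "\<And>j. N (\<lambda>w. of_real (g j w)) \<le> c"
  shows "extended_qnorm E N M (\<lambda>w. SUP j. ennreal (g j w)) \<le> ennreal c"
proof -
  have gm[measurable]: "g j \<in> borel_measurable M" for j
  proof -
    have [measurable]: "(\<lambda>w. of_real (g j w) :: 'b) \<in> borel_measurable M"
      using g(1)[of j] subset_L0 by blast
    have "(\<lambda>w. norm (of_real (g j w) :: 'b)) \<in> borel_measurable M" by measurable
    then show ?thesis using g(2) by simp
  qed
  define G where "G w = (SUP j. ennreal (g j w))" for w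
  have Gm[measurable]: "G \<in> borel_measurable M" unfolding G_def by measurable
  define S where "S = {w \<in> space M. G w = \<infinity>}"
  have S[measurable]: "S \<in> sets M" unfolding S_def by measurable
  have mono: "g i w \<le> g j w" if "i \<le> j" for i j w
    using lift_Suc_mono_le[of "\<lambda>j. g j w"] g(3) that by auto
  have S_bound: "(\<lambda>w. of_real (m * indicator S w)) \<in> E \<and> N (\<lambda>w. of_real (m * indicator S w)) \<le> c"
    if m: "0 < m" for m :: real
  proof -
    define h where "h j w = min (g j w) m * indicator S w" for j w
    have hE: "(\<lambda>w. of_real (h j w)) \<in> E \<and> N (\<lambda>w. of_real (h j w)) \<le> N (\<lambda>w. of_real (g j w))" for j
    proof (rule ideal[OF g(1)])
      show "(\<lambda>w. of_real (h j w) :: 'b) \<in> borel_measurable M" unfolding h_def by measurable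
      show "AE w in M. norm (of_real (h j w) :: 'b) \<le> norm (of_real (g j w) :: 'b)"
        using g(2) m by (auto simp: h_def indicator_def)
    qed
    have hc: "N (\<lambda>w. of_real (h j w)) \<le> c" for j using hE[of j] c[of j] by auto
    have lim: "(\<lambda>j. h j w) \<longlonglongrightarrow> m * indicator S w" for w
    proof (cases "w \<in> S")
      case True
      then have "G w = \<infinity>" by (simp add: S_def)
      then have "ennreal m < G w" by simp
      then have "ennreal m < (SUP j. ennreal (g j w))" unfolding G_def .
      then obtain i where "ennreal m < ennreal (g i w)" unfolding less_SUP_iff by blast
      then have "m < g i w" using m by (simp add: ennreal_less_iff)
      then have "eventually (\<lambda>j. h j w = m * indicator S w) sequentially"
        unfolding eventually_sequentially using mono[of i _ w]
        by (intro exI[of _ i]) (force simp: h_def min_def)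
      then show ?thesis by (rule tendsto_eventually)
    qed (simp add: h_def)
    have "(\<lambda>w. of_real (m * indicator S w)) \<in> E \<and>
      (\<lambda>j. N (\<lambda>w. of_real (h j w))) \<longlonglongrightarrow> N (\<lambda>w. of_real (m * indicator S w))"
      using fatou unfolding fatou_property_def
    proof (elim allE impE)
      show "(\<lambda>w. m * indicator S w) \<in> borel_measurable M" by measurable
      show "AE w in M. \<forall>j. 0 \<le> h j w \<and> h j w \<le> h (Suc j) w"
        using g(2,3) m by (auto simp: h_def intro!: mult_right_mono min.mono)
      show "bdd_above (range (\<lambda>j. N (\<lambda>w. of_real (h j w))))" using hc by (intro bdd_aboveI2)
    qed (use hE lim in auto)
    then show ?thesis using hc by (auto intro: LIMSEQ_le_const2)
  qed
  have S_mem: "(\<lambda>w. of_real (indicator S w)) \<in> E" using S_bound[of 1] by simp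
  have "N (\<lambda>w. of_real (indicator S w)) \<le> 0"
  proof (rule ccontr)
    let ?a = "N (\<lambda>w. of_real (indicator S w))"
    assume "\<not> ?a \<le> 0"
    then have a: "0 < ?a" by simp
    have "m * ?a \<le> c" if "0 < m" for m :: real
      using S_bound[OF that] qnorm_scale[OF S_mem, of "of_real m"] that by simp
    from this[of "(\<bar>c\<bar> + 1) / ?a"] a show False by simp
  qed
  then have "N (\<lambda>w. of_real (indicator S w)) = 0" using qnorm_nonneg[OF S_mem] by simp
  then have "AE w in M. (of_real (indicator S w) :: 'b) = 0" using qnorm_eq_0_iff[OF S_mem] by simp
  then have fin: "AE w in M. G w < \<infinity>"
    using AE_space by eventually_elim (auto simp: S_def indicator_def less_top[symmetric])
  have lim: "AE w in M. (\<lambda>j. g j w) \<longlonglongrightarrow> enn2real (G w)"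
    using fin
  proof eventually_elim
    case (elim w)
    have "(\<lambda>j. ennreal (g j w)) \<longlonglongrightarrow> G w"
      unfolding G_def by (intro LIMSEQ_SUP incseq_SucI ennreal_leI g(3))
    then have "(\<lambda>j. enn2real (ennreal (g j w))) \<longlonglongrightarrow> enn2real (G w)"
      using elim by (intro tendsto_enn2real) auto
    then show ?case using g(2) by simp
  qed
  have "(\<lambda>w. of_real (enn2real (G w))) \<in> E \<and>
      (\<lambda>j. N (\<lambda>w. of_real (g j w))) \<longlonglongrightarrow> N (\<lambda>w. of_real (enn2real (G w)))"
    using fatou unfolding fatou_property_def
  proof (elim allE impE)
    show "(\<lambda>w. enn2real (G w)) \<in> borel_measurable M" by measurable
    show "bdd_above (range (\<lambda>j. N (\<lambda>w. of_real (g j w))))" using c by (intro bdd_aboveI2)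
  qed (use g lim in auto)
  then have "(\<lambda>w. of_real (enn2real (G w))) \<in> E" "N (\<lambda>w. of_real (enn2real (G w))) \<le> c"
    using c by (auto intro: LIMSEQ_le_const2)
  then show ?thesis
    using fin unfolding extended_qnorm_def G_def by (simp add: ennreal_leI)
qed

end

section \<open>Numerical inequalities\<close>

text \<open>
  The quasi-triangle inequality of the two-dimensional \<open>\<ell>\<^sub>q\<close>, on its unit sphere: the \<open>\<ell>\<^sub>1\<close>-sum dominates
  the \<open>\<ell>\<^sub>q\<close>-sum for \<open>q \<ge> 1\<close>, and for \<open>q < 1\<close> the constant comes from convexity of \<open>t \<mapsto> t\<^bsup>1/q\<^esup>\<close>.
\<close>

lemma one_le_quasi_sum:
  fixes a b q :: real
  assumes q: "0 < q" and ab: "0 \<le> a" "0 \<le> b" "a powr q + b powr q = 1"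
  shows "1 \<le> max 1 (2 powr (1 / q - 1)) * (a + b)"
proof (cases "1 \<le> q")
  case True
  have le1: "x \<le> 1" if "x powr q \<le> 1" "0 \<le> x" for x
  proof (rule ccontr)
    assume "\<not> x \<le> 1"
    then have "1 powr q < x powr q" using q by (intro powr_less_mono2) auto
    with that show False by simp
  qed
  have "0 \<le> a powr q" "0 \<le> b powr q" by auto
  with ab(3) have "a powr q \<le> 1" "b powr q \<le> 1" by linarith+
  then have "a \<le> 1" "b \<le> 1" using ab le1 by blast+
  then have "a powr q \<le> a powr 1" "b powr q \<le> b powr 1"
    using True ab powr_mono'[of 1 q a] powr_mono'[of 1 q b] by auto
  then have "1 * 1 \<le> 1 * (a + b)" using ab by simp
  also have "\<dots> \<le> max 1 (2 powr (1 / q - 1)) * (a + b)" using ab by (intro mult_right_mono) auto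
  finally show ?thesis by simp
next
  case False
  then have r: "1 \<le> 1 / q" using q by simp
  define x y where "x = a powr q" and "y = b powr q"
  have ab_eq: "x powr (1 / q) = a" "y powr (1 / q) = b"
    using ab q by (simp_all add: x_def y_def powr_powr)
  show ?thesis
  proof (cases "x = 0 \<or> y = 0")
    case True
    then have "1 \<le> a + b"
    proof
      assume "x = 0" then have "y = 1" using ab by (simp add: x_def y_def)
      then show ?thesis using ab_eq ab by simp
    next
      assume "y = 0" then have "x = 1" using ab by (simp add: x_def y_def)
      then show ?thesis using ab_eq ab by simp
    qed
    then have "1 * 1 \<le> 1 * (a + b)" by simp
    also have "\<dots> \<le> max 1 (2 powr (1 / q - 1)) * (a + b)" using ab by (intro mult_right_mono) auto
    finally show ?thesis by simp
  next
    case False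
    then have pos: "0 < x" "0 < y" by (auto simp: x_def y_def)
    have mid: "(1 - 1/2) *\<^sub>R x + (1/2) *\<^sub>R y = 1 / 2"
      using ab(3) unfolding x_def[symmetric] y_def[symmetric] by simp
    have "((1 - 1/2) *\<^sub>R x + (1/2) *\<^sub>R y) powr (1 / q)
        \<le> (1 - 1/2) * x powr (1 / q) + (1/2) * y powr (1 / q)"
      by (rule convex_onD[OF powr_convex[OF r]]) (use pos in auto)
    then have half: "(1 / 2) powr (1 / q) \<le> (a + b) / 2"
      unfolding mid ab_eq by simp
    have "1 = 2 powr (1 / q) * (1 / 2) powr (1 / q)" by (simp add: powr_mult[symmetric])
    also have "\<dots> \<le> 2 powr (1 / q) * ((a + b) / 2)" using half by (intro mult_left_mono) auto
    also have "\<dots> = 2 powr (1 / q - 1) * (a + b)" by (simp add: powr_diff)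
    also have "\<dots> \<le> max 1 (2 powr (1 / q - 1)) * (a + b)" using ab by (intro mult_right_mono) auto
    finally show ?thesis .
  qed
qed

text \<open>
  With \<open>y = \<theta>\<^bsup>1/q\<^esup>\<close>, the left-hand side results from the weights \<open>2\<^bsup>r+1\<^esup>\<close> on the levels, whereas the
  right-hand side would result from a triangle inequality with constant \<open>\<kappa>\<close> applied level after level.
  The former is the smaller one by the previous lemma, applied to \<open>a = 2 y\<close> and \<open>b\<close> with
  \<open>a\<^sup>q + b\<^sup>q = 1\<close>; the constant there is \<open>\<kappa> / 2\<close>.
\<close>

lemma dyadic_weights_bound:
  fixes q y \<kappa> :: real
  assumes q: "0 < q" and y: "0 \<le> y" and \<kappa>: "\<kappa> = max 2 (2 powr (1 / q))" and \<kappa>y: "\<kappa> * y < 1"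
  shows "(2 * y) powr q < 1"
    "2 * (1 / (1 - (2 * y) powr q)) powr (1 / q) \<le> \<kappa> / (1 - \<kappa> * y)"
proof -
  have "2 * y \<le> \<kappa> * y" using y \<kappa> by (intro mult_right_mono) auto
  then have "2 * y < 1" using \<kappa>y by simp
  then show lt: "(2 * y) powr q < 1"
    using powr_less_mono2[of q "2 * y" 1] q y by simp
  define b where "b = (1 - (2 * y) powr q) powr (1 / q)"
  have b: "0 < b" "b powr q = 1 - (2 * y) powr q"
    using lt q by (simp_all add: b_def powr_powr)
  have "\<kappa> = 2 * max 1 (2 powr (1 / q - 1))" unfolding \<kappa> by (simp add: max_def powr_diff)
  then have c: "max 1 (2 powr (1 / q - 1)) = \<kappa> / 2" by simp
  have "1 \<le> \<kappa> / 2 * (2 * y + b)"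
    unfolding c[symmetric] using q y b by (intro one_le_quasi_sum) auto
  then have "2 * (1 - \<kappa> * y) \<le> \<kappa> * b" by (simp add: algebra_simps)
  then have "2 / b \<le> \<kappa> / (1 - \<kappa> * y)" using b \<kappa>y by (simp add: field_simps)
  then show "2 * (1 / (1 - (2 * y) powr q)) powr (1 / q) \<le> \<kappa> / (1 - \<kappa> * y)"
    by (simp add: powr_divide b_def)
qed

text \<open>
  For any ratio \<open>s\<close> the level bounds add up to the constant
  \<open>\<kappa> K\<^bsup>1/q\<^esup> / (1 - \<kappa> \<theta>\<^bsup>1/q\<^esup>) = \<kappa> / ((1 - s\<^bsup>q/p\<^esup>)\<^bsup>1/q\<^esup> - \<kappa> (1 - s)\<^bsup>1/p\<^esup>)\<close>.  The present \<open>s\<close> satisfies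
  \<open>s\<^bsup>q/p\<^esup> = 1/D\<close>, so that this becomes the \<open>\<delta>\<close> of the theorem.  The series converges because
  \<open>p < q\<close> and \<open>D > 1\<close> imply \<open>D\<^bsup>p/q\<^esup> - 1 < D - 1 = \<kappa>\<^bsup>-\<tau>\<^esup>\<close>.
\<close>

lemma splitting_ratio_constant:
  fixes p q \<kappa> \<tau> D s K \<theta> :: real
  assumes p: "0 < p" and pq: "p < q" and \<kappa>: "0 < \<kappa>"
    and \<tau>: "\<tau> = 1 / (1 / p - 1 / q)" and D: "D = 1 + \<kappa> powr (- \<tau>)" and s: "s = D powr (- (p / q))"
    and K: "K = 1 / (1 - s powr (q / p))" and \<theta>: "\<theta> = (1 - s) powr (q / p) * K"
  shows "0 < s" "s < 1" "0 < K" "0 \<le> \<theta>" "\<kappa> * \<theta> powr (1 / q) < 1"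
    "\<kappa> * K powr (1 / q) / (1 - \<kappa> * \<theta> powr (1 / q))
       = D powr (1 / q) / (\<kappa> powr (- \<tau> / p) - (D powr (p / q) - 1) powr (1 / p))"
proof -
  have q: "0 < q" using p pq by simp
  define X where "X = \<kappa> powr (- \<tau>)"
  have X: "0 < X" using \<kappa> by (simp add: X_def)
  have D1: "1 < D" using X by (simp add: D X_def)
  show s0: "0 < s" using D1 by (simp add: s)
  have Dpq: "1 < D powr (p / q)" using D1 p q powr_less_mono2[of "p / q" 1 D] by simp
  have s_eq: "s = 1 / D powr (p / q)" by (simp add: s powr_minus_divide)
  then show s1: "s < 1" using Dpq by (simp only: divide_less_eq_1) simp
  have s_powr: "s powr (q / p) = 1 / D"
    using p q D1 by (simp add: s_eq powr_divide powr_powr)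
  have "X = D - 1" by (simp add: D X_def)
  then have K_eq: "K = D / X" using D1 unfolding K s_powr by (simp add: field_simps)
  show K0: "0 < K" unfolding K_eq using D1 X by simp
  show \<theta>0: "0 \<le> \<theta>" using K0 by (simp add: \<theta>)
  define Y where "Y = \<kappa> powr (- \<tau> / p)"
  define Z where "Z = (D powr (p / q) - 1) powr (1 / p)"
  have Y0: "0 < Y" using \<kappa> by (simp add: Y_def)
  have "D powr (p / q) < D powr 1" using D1 p pq q by (intro powr_less_mono) auto
  then have "D powr (p / q) - 1 < X" using D1 by (simp add: D X_def)
  then have "Z < X powr (1 / p)" unfolding Z_def using p Dpq by (intro powr_less_mono2) auto
  then have ZY: "Z < Y" by (simp add: X_def Y_def powr_powr)
  have exponent: "1 + \<tau> / q = \<tau> / p"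
  proof -
    have "1 / p - 1 / q \<noteq> 0" using p pq by (simp add: field_simps)
    then have "\<tau> * (1 / p - 1 / q) = 1" by (simp add: \<tau>)
    then show ?thesis by (simp add: algebra_simps)
  qed
  have "\<kappa> / X powr (1 / q) = \<kappa> powr 1 * \<kappa> powr (\<tau> / q)"
    using \<kappa> by (simp add: X_def powr_powr powr_minus_divide powr_divide)
  also have "\<dots> = \<kappa> powr (\<tau> / p)" by (simp only: powr_add[symmetric] exponent)
  finally have \<kappa>X: "\<kappa> / X powr (1 / q) = 1 / Y" by (simp add: Y_def powr_minus_divide)
  have "1 - s = (D powr (p / q) - 1) / D powr (p / q)"
    using D1 by (simp add: s_eq diff_divide_distrib)
  then have "(1 - s) powr (q / p) = (D powr (p / q) - 1) powr (q / p) / D"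
    using p q D1 by (simp add: powr_divide powr_powr)
  then have "\<theta> = (D powr (p / q) - 1) powr (q / p) / X" using D1 by (simp add: \<theta> K_eq)
  then have "\<theta> powr (1 / q) = Z / X powr (1 / q)" using q by (simp add: Z_def powr_divide powr_powr)
  then have "\<kappa> * \<theta> powr (1 / q) = Z * (\<kappa> / X powr (1 / q))" by simp
  then have \<kappa>\<theta>: "\<kappa> * \<theta> powr (1 / q) = Z / Y" unfolding \<kappa>X by simp
  then show "\<kappa> * \<theta> powr (1 / q) < 1" using ZY Y0 by simp
  have "\<kappa> * K powr (1 / q) = D powr (1 / q) * (\<kappa> / X powr (1 / q))"
    by (simp add: K_eq powr_divide)
  then have \<kappa>K: "\<kappa> * K powr (1 / q) = D powr (1 / q) / Y" unfolding \<kappa>X by simp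
  have "1 - Z / Y = (Y - Z) / Y" using Y0 by (simp add: diff_divide_distrib)
  then have "\<kappa> * K powr (1 / q) / (1 - \<kappa> * \<theta> powr (1 / q)) = D powr (1 / q) / (Y - Z)"
    unfolding \<kappa>\<theta> \<kappa>K using Y0 by simp
  then show "\<kappa> * K powr (1 / q) / (1 - \<kappa> * \<theta> powr (1 / q))
       = D powr (1 / q) / (\<kappa> powr (- \<tau> / p) - (D powr (p / q) - 1) powr (1 / p))"
    unfolding Y_def Z_def .
qed

lemma geometric_sum_le:
  fixes x :: real
  assumes "0 \<le> x" "x < 1"
  shows "(\<Sum>r<n. x ^ r) \<le> 1 / (1 - x)"
  using assms by (simp add: sum_gp_strict divide_right_mono)

lemma power_powr_swap: "0 \<le> (x::real) \<Longrightarrow> (x ^ r) powr a = (x powr a) ^ r"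
  by (induction r) (simp_all add: powr_mult)

section \<open>Summing over levels\<close>

context quasi_banach_function_lattice
begin

text \<open>
  Since \<open>\<Sum>\<^sub>r 2\<^bsup>-(r+1)\<^esup> \<le> 1\<close>, a sum of nonnegative numbers \<open>a\<^sub>r\<close> is at most \<open>2\<^bsup>r+1\<^esup> a\<^sub>r\<close> for some \<open>r\<close>.  So \<open>g\<close> is
  pointwise dominated by one of the functions \<open>2\<^bsup>r+1\<^esup> h\<^sub>B\<close> with \<open>B \<in> L\<^sub>r\<close>, and the upper estimate is needed
  only once, for all of them together.
\<close>

lemma dyadic_level_bound:
  fixes q K \<theta> W :: real
  assumes fin: "upper_const E N M (ennreal q) < \<infinity>" and q: "0 < q" and n: "0 < n"
    and L: "\<And>r. finite (L r)" "\<And>r. L r \<noteq> {}" "\<And>r B. B \<in> L r \<Longrightarrow> h B \<in> E"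
    and sum: "\<And>r. (\<Sum>B\<in>L r. N (h B) powr q) \<le> K * \<theta> ^ r * W powr q"
    and nonneg: "0 \<le> K" "0 \<le> \<theta>" "0 \<le> W" and small: "2 powr q * \<theta> < 1"
    and g: "g \<in> borel_measurable M"
    and dom: "AE w in M. \<exists>b. (\<forall>r<n. b r \<in> L r) \<and> norm (g w) \<le> (\<Sum>r<n. norm (h (b r) w))"
  shows "g \<in> E"
    "N g \<le> enn2real (upper_const E N M (ennreal q)) *
       (2 * W * (K / (1 - 2 powr q * \<theta>)) powr (1 / q))"
proof -
  define I where "I = Sigma {..<n} L"
  define h' where "h' = (\<lambda>(r, B) w. of_real (2 ^ Suc r) * h B w)"
  have h': "h' (r, B) = (\<lambda>w. of_real (2 ^ Suc r) * h B w)" for r B by (simp add: h'_def)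
  obtain B0 where "B0 \<in> L 0" using L(2) by blast
  then have "(0, B0) \<in> I" using n by (simp add: I_def)
  then have I: "finite I" "I \<noteq> {}" using L(1) by (auto simp: I_def)
  have h'E: "h' i \<in> E" if "i \<in> I" for i
    using that L(3) by (auto simp: I_def h' intro!: scale_mem)
  have dom': "AE w in M. \<exists>i\<in>I. norm (g w) \<le> norm (h' i w)"
    using dom
  proof eventually_elim
    case (elim w)
    then obtain b where b: "\<forall>r<n. b r \<in> L r" "norm (g w) \<le> (\<Sum>r<n. norm (h (b r) w))" by blast
    have "\<exists>r<n. norm (g w) \<le> 2 ^ Suc r * norm (h (b r) w)"
    proof (rule ccontr)
      assume "\<not> ?thesis"
      then have lt: "norm (h (b r) w) < norm (g w) * (1 / 2) ^ Suc r" if "r < n" for r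
        using that by (auto simp: not_le field_simps power_divide)
      have half: "(\<Sum>r<n. (1 / 2 :: real) ^ Suc r) = 1 - (1 / 2) ^ n" for n
        by (induction n) auto
      have "norm (g w) \<le> (\<Sum>r<n. norm (h (b r) w))" by (rule b(2))
      also have "\<dots> < (\<Sum>r<n. norm (g w) * (1 / 2) ^ Suc r)"
        using lt n by (intro sum_strict_mono) auto
      also have "\<dots> = norm (g w) * (1 - (1 / 2) ^ n)"
        unfolding half[symmetric] by (simp add: sum_distrib_left)
      also have "\<dots> \<le> norm (g w) * 1" by (intro mult_left_mono) auto
      finally show False by simp
    qed
    then obtain r where "r < n" "norm (g w) \<le> 2 ^ Suc r * norm (h (b r) w)" by blast
    with b(1) show ?case
      by (intro bexI[of _ "(r, b r)"]) (auto simp: I_def h' norm_mult norm_power)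
  qed
  note * = upper_estimate_dominated_sum[OF fin q I h'E g dom']
  show "g \<in> E" by (rule *(1))
  have "(\<Sum>i\<in>I. N (h' i) powr q) = (\<Sum>r<n. \<Sum>B\<in>L r. N (h' (r, B)) powr q)"
    unfolding I_def using L(1) by (subst sum.Sigma) (auto simp: case_prod_unfold)
  also have "\<dots> = (\<Sum>r<n. (2 powr q) ^ Suc r * (\<Sum>B\<in>L r. N (h B) powr q))"
    unfolding sum_distrib_left
  proof (intro sum.cong refl)
    fix r B assume "B \<in> L r"
    then have "N (h' (r, B)) = 2 ^ Suc r * N (h B)"
      unfolding h' using qnorm_scale[OF L(3), of B r "of_real (2 ^ Suc r)"]
      by (simp add: norm_mult norm_power)
    then show "N (h' (r, B)) powr q = (2 powr q) ^ Suc r * N (h B) powr q"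
      using power_powr_swap[of 2 "Suc r" q] by (simp only: powr_mult)
  qed
  also have "\<dots> \<le> (\<Sum>r<n. (2 powr q) ^ Suc r * (K * \<theta> ^ r * W powr q))"
    by (intro sum_mono mult_left_mono sum) auto
  also have "\<dots> = 2 powr q * K * W powr q * (\<Sum>r<n. (2 powr q * \<theta>) ^ r)"
    unfolding sum_distrib_left by (intro sum.cong refl) (simp add: power_mult_distrib)
  also have "\<dots> \<le> 2 powr q * K * W powr q * (1 / (1 - 2 powr q * \<theta>))"
    using nonneg small by (intro mult_left_mono geometric_sum_le) auto
  also have "\<dots> = 2 powr q * W powr q * (K / (1 - 2 powr q * \<theta>))" by simp
  finally have "(\<Sum>i\<in>I. N (h' i) powr q) powr (1 / q)
      \<le> (2 powr q * W powr q * (K / (1 - 2 powr q * \<theta>))) powr (1 / q)"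
    using q by (intro powr_mono2) (auto intro!: sum_nonneg)
  also have "\<dots> = 2 * W * (K / (1 - 2 powr q * \<theta>)) powr (1 / q)"
    using nonneg q by (simp only: powr_mult powr_powr) simp
  finally have "(\<Sum>i\<in>I. N (h' i) powr q) powr (1 / q)
      \<le> 2 * W * (K / (1 - 2 powr q * \<theta>)) powr (1 / q)" .
  then show "N g \<le> enn2real (upper_const E N M (ennreal q)) *
       (2 * W * (K / (1 - 2 powr q * \<theta>)) powr (1 / q))"
    by (intro order_trans[OF *(2)] mult_left_mono) auto
qed

end

context banach_function_lattice
begin

lemma qnorm_sum_le:
  assumes "finite I" "\<And>i. i \<in> I \<Longrightarrow> f i \<in> E"
  shows "N (\<lambda>w. \<Sum>i\<in>I. f i w) \<le> (\<Sum>i\<in>I. N (f i))"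
  using assms
proof (induction I rule: finite_induct)
  case empty
  then show ?case by (simp add: qnorm_zero)
next
  case (insert i I)
  then have "N (\<lambda>w. f i w + (\<Sum>i\<in>I. f i w)) \<le> N (f i) + N (\<lambda>w. \<Sum>i\<in>I. f i w)"
    by (intro triangle sum_mem) auto
  then show ?case using insert by force
qed

text \<open>
  The upper estimate is applied to each level separately, to the maximum \<open>G\<^sub>r\<close> of its functions; the norm
  then adds the levels.
\<close>

lemma additive_level_bound:
  fixes q K \<theta> W :: real
  assumes fin: "upper_const E N M (ennreal q) < \<infinity>" and q: "0 < q"
    and L: "\<And>r. finite (L r)" "\<And>r. L r \<noteq> {}" "\<And>r B. B \<in> L r \<Longrightarrow> h B \<in> E"
    and sum: "\<And>r. (\<Sum>B\<in>L r. N (h B) powr q) \<le> K * \<theta> ^ r * W powr q"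
    and nonneg: "0 \<le> K" "0 \<le> \<theta>" "0 \<le> W" and small: "\<theta> powr (1 / q) < 1"
    and g: "g \<in> borel_measurable M"
    and dom: "AE w in M. \<exists>b. (\<forall>r<n. b r \<in> L r) \<and> norm (g w) \<le> (\<Sum>r<n. norm (h (b r) w))"
  shows "N g \<le> enn2real (upper_const E N M (ennreal q)) *
       (W * (K powr (1 / q) / (1 - \<theta> powr (1 / q))))"
proof -
  let ?u = "enn2real (upper_const E N M (ennreal q))"
  define G where "G r w = Max ((\<lambda>B. norm (h B w)) ` L r)" for r w
  have hm: "h B \<in> borel_measurable M" if "B \<in> L r" for B r using L(3)[OF that] subset_L0 by blast
  have Gm: "G r \<in> borel_measurable M" for r
    unfolding G_def using L(1) hm by (intro borel_measurable_Max borel_measurable_norm) auto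
  have G_ge: "norm (h B w) \<le> G r w" if "B \<in> L r" for B r w
    unfolding G_def using L(1) that by (intro Max_ge) auto
  have G0: "0 \<le> G r w" for r w using L(2)[of r] G_ge[of _ r w] norm_ge_zero order_trans by blast
  have G: "(\<lambda>w. of_real (G r w)) \<in> E"
    "N (\<lambda>w. of_real (G r w)) \<le> ?u * (W * K powr (1 / q) * (\<theta> powr (1 / q)) ^ r)" for r
  proof -
    have dom_G: "AE w in M. \<exists>B\<in>L r. norm (of_real (G r w) :: 'b) \<le> norm (h B w)"
    proof (intro AE_I2)
      fix w
      have "G r w \<in> (\<lambda>B. norm (h B w)) ` L r" unfolding G_def using L by (intro Max_in) auto
      then show "\<exists>B\<in>L r. norm (of_real (G r w) :: 'b) \<le> norm (h B w)" by auto
    qed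
    have "(\<lambda>w. of_real (G r w) :: 'b) \<in> borel_measurable M" using Gm by measurable
    note * = upper_estimate_dominated_sum[OF fin q L(1,2) L(3) this dom_G]
    show "(\<lambda>w. of_real (G r w)) \<in> E" by (rule *(1))
    have "(\<Sum>B\<in>L r. N (h B) powr q) powr (1 / q) \<le> (K * \<theta> ^ r * W powr q) powr (1 / q)"
      using q by (intro powr_mono2 sum) (auto intro!: sum_nonneg)
    also have "\<dots> = W * K powr (1 / q) * (\<theta> powr (1 / q)) ^ r"
      using nonneg q by (simp add: powr_mult powr_powr power_powr_swap)
    finally have "(\<Sum>B\<in>L r. N (h B) powr q) powr (1 / q)
        \<le> W * K powr (1 / q) * (\<theta> powr (1 / q)) ^ r" .
    then show "N (\<lambda>w. of_real (G r w)) \<le> ?u * (W * K powr (1 / q) * (\<theta> powr (1 / q)) ^ r)"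
      by (intro order_trans[OF *(2)] mult_left_mono) auto
  qed
  have "N g \<le> N (\<lambda>w. \<Sum>r<n. of_real (G r w))"
  proof (rule conjunct2[OF ideal[OF sum_mem g]])
    show "AE w in M. norm (g w) \<le> norm (\<Sum>r<n. of_real (G r w) :: 'b)"
      using dom
    proof eventually_elim
      case (elim w)
      then obtain b where b: "\<forall>r<n. b r \<in> L r" "norm (g w) \<le> (\<Sum>r<n. norm (h (b r) w))" by blast
      note b(2)
      also have "(\<Sum>r<n. norm (h (b r) w)) \<le> (\<Sum>r<n. G r w)"
        using b(1) by (intro sum_mono G_ge) auto
      also have "\<dots> = norm (of_real (\<Sum>r<n. G r w) :: 'b)"
        using G0 by (simp only: norm_of_real) (simp add: sum_nonneg)
      finally show ?case by simp
    qed
  qed (rule G(1))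
  also have "\<dots> \<le> (\<Sum>r<n. N (\<lambda>w. of_real (G r w)))" by (intro qnorm_sum_le G(1)) auto
  also have "\<dots> \<le> (\<Sum>r<n. ?u * (W * K powr (1 / q) * (\<theta> powr (1 / q)) ^ r))"
    by (intro sum_mono G(2))
  also have "\<dots> = ?u * (W * K powr (1 / q) * (\<Sum>r<n. (\<theta> powr (1 / q)) ^ r))"
    by (simp add: sum_distrib_left)
  also have "\<dots> \<le> ?u * (W * K powr (1 / q) * (1 / (1 - \<theta> powr (1 / q))))"
    using nonneg small by (intro mult_left_mono geometric_sum_le) auto
  finally show ?thesis by simp
qed

end

section \<open>Decomposing the maximal operator\<close>

text \<open>
  The value 0 is inserted to make the maximum meaningful for empty \<open>J\<close>.
\<close>

definition truncated_maximal ::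
  "'i set \<Rightarrow> ('i \<Rightarrow> 'a set) \<Rightarrow> (('a \<Rightarrow> 'k::real_normed_field) \<Rightarrow> ('b \<Rightarrow> 'k)) \<Rightarrow> ('a \<Rightarrow> 'k) \<Rightarrow> 'b \<Rightarrow> real"
  where
  "truncated_maximal J A T f w =
     Max (insert 0 ((\<lambda>\<alpha>. norm (T (\<lambda>v. f v * indicator (A \<alpha>) v) w)) ` J))"

lemma truncated_maximal_cases:
  assumes "finite J"
  obtains "truncated_maximal J A T f w = 0"
  | \<alpha> where "\<alpha> \<in> J" "truncated_maximal J A T f w = norm (T (\<lambda>v. f v * indicator (A \<alpha>) v) w)"
proof -
  have "truncated_maximal J A T f w \<in> insert 0 ((\<lambda>\<alpha>. norm (T (\<lambda>v. f v * indicator (A \<alpha>) v) w)) ` J)"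
    unfolding truncated_maximal_def using assms by (intro Max_in) auto
  then show ?thesis using that by blast
qed

lemma truncated_maximal_nonneg: "finite J \<Longrightarrow> 0 \<le> truncated_maximal J A T f w"
  unfolding truncated_maximal_def by (intro Max_ge) auto

lemma bounded_linear_operatorD:
  assumes "bounded_linear_operator E NE M F NF M' T"
  shows "f \<in> E \<Longrightarrow> T f \<in> F"
    "f \<in> E \<Longrightarrow> g \<in> E \<Longrightarrow> AE w in M'. T (\<lambda>v. f v + g v) w = T f w + T g w"
    "f \<in> E \<Longrightarrow> AE w in M'. T (\<lambda>v. c * f v) w = c * T f w"
  using assms unfolding bounded_linear_operator_def by simp_all

lemma operator_zero:
  assumes T: "bounded_linear_operator E NE M F NF M' T" and f: "f \<in> E"
  shows "AE w in M'. T (\<lambda>v. 0) w = 0"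
proof -
  have "AE w in M'. T (\<lambda>v. 0 * f v) w = 0 * T f w"
    by (rule bounded_linear_operatorD(3)[OF T f])
  then show ?thesis by simp
qed

lemma operator_disjoint_union:
  fixes n :: nat
  assumes E: "quasi_banach_function_lattice M E NE"
    and T: "bounded_linear_operator E NE M F NF M' T" and f: "f \<in> E"
    and b: "\<And>r. r < n \<Longrightarrow> b r \<in> sets M" "disjoint_family_on b {..<n}"
  shows "AE w in M'. T (\<lambda>v. f v * indicator (\<Union>r<n. b r) v) w
    = (\<Sum>r<n. T (\<lambda>v. f v * indicator (b r) v) w)"
  using b
proof (induction n)
  case 0
  then show ?case using operator_zero[OF T f] by simp
next
  case (Suc n)
  interpret E: quasi_banach_function_lattice M E NE by (rule E)
  let ?B = "\<Union>r<n. b r"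
  have IH: "AE w in M'. T (\<lambda>v. f v * indicator ?B v) w = (\<Sum>r<n. T (\<lambda>v. f v * indicator (b r) v) w)"
    using Suc.prems by (intro Suc.IH) (auto simp: disjoint_family_on_def)
  have B: "?B \<in> sets M" "b n \<in> sets M" using Suc.prems by auto
  have "b r \<inter> b n = {}" if "r < n" for r
    using that by (intro disjoint_family_onD[OF Suc.prems(2)]) auto
  then have "?B \<inter> b n = {}" by blast
  then have "(\<lambda>v. f v * indicator (\<Union>r<Suc n. b r) v)
      = (\<lambda>v. f v * indicator ?B v + f v * indicator (b n) v)"
    by (auto simp: fun_eq_iff lessThan_Suc indicator_def)
  moreover have "AE w in M'. T (\<lambda>v. f v * indicator ?B v + f v * indicator (b n) v) w
      = T (\<lambda>v. f v * indicator ?B v) w + T (\<lambda>v. f v * indicator (b n) v) w"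
    by (rule bounded_linear_operatorD(2)[OF T]; intro E.restrict_mem(1)[OF f] B)
  ultimately have "AE w in M'. T (\<lambda>v. f v * indicator (\<Union>r<Suc n. b r) v) w
      = T (\<lambda>v. f v * indicator ?B v) w + T (\<lambda>v. f v * indicator (b n) v) w"
    by simp
  with IH show ?case by eventually_elim simp
qed

text \<open>
  The decomposition of the chain is applied to the superadditive majorant of \<open>f\<close> with \<open>\<sigma> = q/p\<close>.  The
  levels here always contain the empty set, which costs nothing as \<open>T 0 = 0\<close>; this also covers the points
  where the maximum is 0.
\<close>

lemma maximal_levels:
  fixes p q s :: real and A :: "'i::linorder \<Rightarrow> 'a set"
    and E :: "('a \<Rightarrow> 'k::{real_normed_field, euclidean_space}) set"
  assumes E: "quasi_banach_function_lattice M E NE" and F: "quasi_banach_function_lattice M' F NF"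
    and T: "bounded_linear_operator E NE M F NF M' T" and f: "f \<in> E"
    and fin: "lower_const E NE M (ennreal p) < \<infinity>" and p: "0 < p" and q: "0 < q"
    and s: "0 < s" "s < 1"
    and K: "K = 1 / (1 - s powr (q / p))" and \<theta>: "\<theta> = (1 - s) powr (q / p) * K"
    and J: "finite J" "\<And>j. j \<in> J \<Longrightarrow> A j \<in> sets M"
      "\<And>i j. i \<in> J \<Longrightarrow> j \<in> J \<Longrightarrow> i < j \<Longrightarrow> A i \<subseteq> A j"
  obtains L :: "nat \<Rightarrow> 'a set set" and n where
    "0 < n" "\<And>r. finite (L r)" "\<And>r. L r \<noteq> {}"
    "\<And>r B. B \<in> L r \<Longrightarrow> T (\<lambda>v. f v * indicator B v) \<in> F"
    "\<And>r. (\<Sum>B\<in>L r. NF (T (\<lambda>v. f v * indicator B v)) powr q) \<le> K * \<theta> ^ r *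
       (enn2real (operator_norm E NE NF T) * (enn2real (lower_const E NE M (ennreal p)) * NE f)) powr q"
    "AE w in M'. \<exists>b. (\<forall>r<n. b r \<in> L r) \<and>
       norm (of_real (truncated_maximal J A T f w) :: 'k) \<le> (\<Sum>r<n. norm (T (\<lambda>v. f v * indicator (b r) v) w))"
proof -
  interpret E: quasi_banach_function_lattice M E NE by (rule E)
  interpret F: quasi_banach_function_lattice M' F NF by (rule F)
  let ?l = "enn2real (lower_const E NE M (ennreal p)) * NE f"
  let ?t = "enn2real (operator_norm E NE NF T)"
  let ?f = "\<lambda>B v. f v * indicator B v"
  obtain \<phi> :: "'a set \<Rightarrow> real" where \<phi>:
    "\<And>B. B \<in> sets M \<Longrightarrow> 0 \<le> \<phi> B"
    "\<And>B C. B \<in> sets M \<Longrightarrow> C \<in> sets M \<Longrightarrow> B \<inter> C = {} \<Longrightarrow> \<phi> B + \<phi> C \<le> \<phi> (B \<union> C)"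
    "\<And>B. B \<in> sets M \<Longrightarrow> NE (?f B) powr p \<le> \<phi> B"
    "\<And>B. B \<in> sets M \<Longrightarrow> \<phi> B \<le> ?l powr p"
    by (rule E.superadditive_majorant[OF fin p f]) (rule that)
  \<comment> \<open>The successor makes \<open>n\<close> positive for empty \<open>J\<close> as well.\<close>
  define n where "n = Suc (card J)"
  have "\<exists>L. (\<forall>r. finite (L r) \<and> L r \<subseteq> sets M \<and>
                (\<Sum>B\<in>L r. \<phi> B powr (q / p)) \<le> K * \<theta> ^ r * (?l powr p) powr (q / p)) \<and>
             (\<forall>j\<in>J. union_of_levels n L (A j))"
    by (rule chain_decomposition[where s = s])
       (use \<phi> s p q K \<theta> J in \<open>auto simp: n_def\<close>)
  then obtain L where
    L': "\<forall>r. finite (L r) \<and> L r \<subseteq> sets M \<and>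
      (\<Sum>B\<in>L r. \<phi> B powr (q / p)) \<le> K * \<theta> ^ r * (?l powr p) powr (q / p)"
    and cover: "\<forall>j\<in>J. union_of_levels n L (A j)"
    by (elim exE conjE) (rule that)
  have l0: "0 \<le> ?l" using E.qnorm_nonneg[OF f] by simp
  have L: "finite (L r)" "L r \<subseteq> sets M" "(\<Sum>B\<in>L r. \<phi> B powr (q / p)) \<le> K * \<theta> ^ r * ?l powr q" for r
    using L' p by (auto simp: powr_powr)
  have sets: "B \<in> sets M" if "B \<in> insert {} (L r)" for B r using L(2) that by auto
  have fB: "?f B \<in> E" if "B \<in> sets M" for B using E.restrict_mem[OF f that] by simp
  have TF: "T g \<in> F" if "g \<in> E" for g
    by (rule bounded_linear_operatorD(1)[OF T that])
  have T_le: "NF (T (?f B)) powr q \<le> ?t powr q * \<phi> B powr (q / p)" if B: "B \<in> sets M" for B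
  proof -
    have N0: "0 \<le> NE (?f B)" by (rule E.qnorm_nonneg[OF fB[OF B]])
    have "NF (T (?f B)) powr q \<le> (?t * NE (?f B)) powr q"
      using q operator_norm_bound(2)[OF T fB[OF B] E.qnorm_nonneg] F.qnorm_nonneg[OF TF[OF fB[OF B]]]
      by (intro powr_mono2) auto
    also have "\<dots> = ?t powr q * (NE (?f B) powr p) powr (q / p)"
      using p by (simp add: powr_mult powr_powr)
    also have "\<dots> \<le> ?t powr q * \<phi> B powr (q / p)"
      using \<phi>(3)[OF B] p q by (intro mult_left_mono powr_mono2) auto
    finally show ?thesis .
  qed
  have T_empty: "NF (T (?f {})) = 0"
    by (rule F.qnorm_eq_0_iff[THEN iffD2]) (use operator_zero[OF T f] TF E.zero_mem in auto)
  show ?thesis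
  proof (rule that[of n "\<lambda>r. insert {} (L r)"])
    fix r
    show "(\<Sum>B\<in>insert {} (L r). NF (T (?f B)) powr q) \<le> K * \<theta> ^ r * (?t * ?l) powr q"
    proof -
      have "(\<Sum>B\<in>insert {} (L r). NF (T (?f B)) powr q) = (\<Sum>B\<in>L r. NF (T (?f B)) powr q)"
        using L(1)[of r] T_empty by (simp add: sum.insert_if)
      also have "\<dots> \<le> (\<Sum>B\<in>L r. ?t powr q * \<phi> B powr (q / p))"
        using L(2) by (intro sum_mono T_le) auto
      also have "\<dots> \<le> ?t powr q * (K * \<theta> ^ r * ?l powr q)"
        unfolding sum_distrib_left[symmetric] by (intro mult_left_mono L) auto
      also have "\<dots> = K * \<theta> ^ r * (?t * ?l) powr q" by (simp add: powr_mult)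
      finally show ?thesis .
    qed
  next
    have "AE w in M'. \<forall>j\<in>J. \<exists>b. (\<forall>r<n. b r \<in> insert {} (L r)) \<and>
       T (?f (A j)) w = (\<Sum>r<n. T (?f (b r)) w)"
    proof (rule AE_ball_countable')
      fix j assume "j \<in> J"
      with cover have "union_of_levels n L (A j)" by blast
      from this[unfolded union_of_levels_def] obtain b where b: "\<forall>r<n. b r \<in> insert {} (L r)" "disjoint_family_on b {..<n}"
        "A j = (\<Union>r<n. b r)" by (elim exE conjE) (rule that)
      have "AE w in M'. T (?f (A j)) w = (\<Sum>r<n. T (?f (b r)) w)"
        unfolding b(3) by (rule operator_disjoint_union[OF E T f]) (use b(1,2) sets in blast)+
      then show "AE w in M'. \<exists>b. (\<forall>r<n. b r \<in> insert {} (L r)) \<and>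
         T (?f (A j)) w = (\<Sum>r<n. T (?f (b r)) w)"
        by eventually_elim (use b(1) in blast)
    qed (use J in \<open>simp add: countable_finite\<close>)
    then show "AE w in M'. \<exists>b. (\<forall>r<n. b r \<in> insert {} (L r)) \<and>
       norm (of_real (truncated_maximal J A T f w) :: 'k) \<le> (\<Sum>r<n. norm (T (?f (b r)) w))"
    proof eventually_elim
      case (elim w)
      show ?case
      proof (cases rule: truncated_maximal_cases[OF J(1), of A T f w])
        case 1
        then show ?thesis by (intro exI[of _ "\<lambda>r. {}"]) (auto intro!: sum_nonneg)
      next
        case (2 j)
        with elim obtain b where b: "\<forall>r<n. b r \<in> insert {} (L r)"
          "T (?f (A j)) w = (\<Sum>r<n. T (?f (b r)) w)" by blast
        have "norm (of_real (truncated_maximal J A T f w) :: 'k) = norm (\<Sum>r<n. T (?f (b r)) w)"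
          by (simp add: 2 b(2))
        also have "\<dots> \<le> (\<Sum>r<n. norm (T (?f (b r)) w))" by (rule norm_sum)
        finally show ?thesis using b(1) by blast
      qed
    qed
  qed (use L(1) sets fB TF in \<open>auto simp: n_def\<close>)
qed

section \<open>From finitely many sets to the whole filtration\<close>

lemma truncated_maximal_measurable:
  fixes T :: "('a \<Rightarrow> 'k::{real_normed_field, euclidean_space}) \<Rightarrow> ('b \<Rightarrow> 'k)"
  assumes E: "quasi_banach_function_lattice M E NE" and F: "quasi_banach_function_lattice M' F NF"
    and T: "bounded_linear_operator E NE M F NF M' T" and f: "f \<in> E"
    and J: "finite J" "\<And>j. j \<in> J \<Longrightarrow> A j \<in> sets M"
  shows "(\<lambda>w. of_real (truncated_maximal J A T f w) :: 'k) \<in> borel_measurable M'"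
proof -
  interpret E: quasi_banach_function_lattice M E NE by (rule E)
  interpret F: quasi_banach_function_lattice M' F NF by (rule F)
  have "T (\<lambda>v. f v * indicator (A j) v) \<in> borel_measurable M'" if "j \<in> J" for j
    using bounded_linear_operatorD(1)[OF T E.restrict_mem(1)[OF f J(2)[OF that]]] F.subset_L0 by blast
  then have "(\<lambda>w. max 0 (Max ((\<lambda>j. norm (T (\<lambda>v. f v * indicator (A j) v) w)) ` J))) \<in> borel_measurable M'"
    using J(1) by (intro borel_measurable_max borel_measurable_Max borel_measurable_norm) auto
  moreover have "truncated_maximal J A T f w = (if J = {} then 0 else
      max 0 (Max ((\<lambda>j. norm (T (\<lambda>v. f v * indicator (A j) v) w)) ` J)))" for w
    unfolding truncated_maximal_def using J(1) by auto
  ultimately have "truncated_maximal J A T f \<in> borel_measurable M'"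
    by (cases "J = {}") (simp_all add: fun_eq_iff cong: measurable_cong)
  then show ?thesis by measurable
qed

text \<open>
  The countable index set is exhausted by the finite sets of indices with a number at most \<open>n\<close>; the
  truncated maximal functions increase to the maximal function at every point.
\<close>

lemma maximal_operator_norm_le:
  fixes T :: "('a \<Rightarrow> 'k::{real_normed_field, euclidean_space}) \<Rightarrow> ('b \<Rightarrow> 'k)"
  assumes E: "quasi_banach_function_lattice M E NE" and F: "quasi_banach_function_lattice M' F NF"
    and fatou: "fatou_property F NF M'" and Q: "countable Q" and C: "0 \<le> C"
    and mem: "\<And>f J. f \<in> E \<Longrightarrow> finite J \<Longrightarrow> J \<subseteq> Q \<Longrightarrow>
      (\<lambda>w. of_real (truncated_maximal J A T f w)) \<in> F"
    and bound: "\<And>f J. f \<in> E \<Longrightarrow> finite J \<Longrightarrow> J \<subseteq> Q \<Longrightarrow>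
      NF (\<lambda>w. of_real (truncated_maximal J A T f w)) \<le> C * NE f"
  shows "maximal_operator_norm E NE F NF M' Q A T \<le> ennreal C"
  unfolding maximal_operator_norm_def
proof (rule Inf_lower, safe)
  interpret E: quasi_banach_function_lattice M E NE by (rule E)
  interpret F: quasi_banach_function_lattice M' F NF by (rule F)
  fix f assume f: "f \<in> E"
  define J where "J n = {\<alpha> \<in> Q. to_nat_on Q \<alpha> \<le> n}" for n
  have J: "finite (J n)" "J n \<subseteq> Q" for n
  proof -
    have "to_nat_on Q ` J n \<subseteq> {..n}" by (auto simp: J_def)
    then have "finite (to_nat_on Q ` J n)" by (rule finite_subset) simp
    moreover have "inj_on (to_nat_on Q) (J n)"
      by (rule inj_on_subset[OF inj_on_to_nat_on[OF Q]]) (auto simp: J_def)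
    ultimately show "finite (J n)" by (rule finite_imageD)
  qed (auto simp: J_def)
  let ?g = "\<lambda>n. truncated_maximal (J n) A T f"
  have "maximal_operator Q A T f w = (SUP n. ennreal (?g n w))" for w
  proof (rule antisym)
    show "maximal_operator Q A T f w \<le> (SUP n. ennreal (?g n w))"
      unfolding maximal_operator_def
    proof (rule SUP_least)
      fix \<alpha> assume "\<alpha> \<in> Q"
      then have "\<alpha> \<in> J (to_nat_on Q \<alpha>)" by (simp add: J_def)
      then have "norm (T (\<lambda>v. f v * indicator (A \<alpha>) v) w) \<le> ?g (to_nat_on Q \<alpha>) w"
        unfolding truncated_maximal_def using J by (intro Max_ge) auto
      then show "ennreal (norm (T (\<lambda>v. f v * indicator (A \<alpha>) v) w)) \<le> (SUP n. ennreal (?g n w))"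
        by (intro SUP_upper2[of "to_nat_on Q \<alpha>"] ennreal_leI) auto
    qed
    show "(SUP n. ennreal (?g n w)) \<le> maximal_operator Q A T f w"
    proof (rule SUP_least)
      fix n
      show "ennreal (?g n w) \<le> maximal_operator Q A T f w"
      proof (cases rule: truncated_maximal_cases[OF J(1)[of n], of A T f w])
        case (2 \<alpha>)
        then show ?thesis unfolding maximal_operator_def
          using J(2)[of n] by (auto intro!: SUP_upper2[of \<alpha>])
      qed simp
    qed
  qed
  then have "extended_qnorm F NF M' (maximal_operator Q A T f)
      = extended_qnorm F NF M' (\<lambda>w. SUP n. ennreal (?g n w))" by presburger
  also have "\<dots> \<le> ennreal (C * NE f)"
  proof (rule F.extended_qnorm_SUP_le[OF fatou])
    fix n w
    show "?g n w \<le> ?g (Suc n) w"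
      unfolding truncated_maximal_def using J
      by (intro Max_mono) (auto simp: J_def)
  next
    fix n
    show "(\<lambda>w. of_real (?g n w)) \<in> F" by (rule mem[OF f J])
  next
    fix n
    show "NF (\<lambda>w. of_real (?g n w)) \<le> C * NE f" by (rule bound[OF f J])
  qed (rule truncated_maximal_nonneg[OF J(1)])
  also have "\<dots> = ennreal C * ennreal (NE f)" using C E.qnorm_nonneg[OF f] by (simp add: ennreal_mult)
  finally show "extended_qnorm F NF M' (maximal_operator Q A T f) \<le> ennreal C * ennreal (NE f)" .
qed

section \<open>The maximal inequality\<close>

lemma recip_ennreal: "0 < q \<Longrightarrow> recip (ennreal q) = 1 / q"
  by (simp add: recip_def inverse_ennreal inverse_eq_divide)

lemma delta_nonneg:
  fixes p q :: real
  assumes p: "0 < p" and pq: "p < q"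
  shows "0 \<le> delta_quasi p (ennreal q)" "0 \<le> delta_banach p (ennreal q)"
proof -
  have q: "0 < q" using p pq by simp
  have nonneg: "0 \<le> D powr (1 / q) / (\<kappa> powr (- \<tau> / p) - (D powr (p / q) - 1) powr (1 / p))"
    if "0 < \<kappa>" "\<tau> = 1 / (1 / p - 1 / q)" "D = 1 + \<kappa> powr (- \<tau>)" for \<kappa> \<tau> D :: real
  proof -
    note split = splitting_ratio_constant[OF p pq that refl refl refl]
    show ?thesis unfolding split(6)[symmetric]
      using split(3,5) that(1) by (intro divide_nonneg_nonneg mult_nonneg_nonneg) auto
  qed
  show "0 \<le> delta_quasi p (ennreal q)"
    using nonneg[OF _ refl refl, of "kappa (ennreal q)"] q
    by (simp add: delta_quasi_def recip_ennreal tau_def kappa_def)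
  show "0 \<le> delta_banach p (ennreal q)"
    using nonneg[OF _ refl refl, of 1] q by (simp add: delta_banach_def recip_ennreal)
qed

lemma truncated_maximal_quasi_bound:
  fixes p q :: real and A :: "'i::linorder \<Rightarrow> 'a set"
    and E :: "('a \<Rightarrow> 'k::{real_normed_field, euclidean_space}) set"
  assumes E: "quasi_banach_function_lattice M E NE" and F: "quasi_banach_function_lattice M' F NF"
    and T: "bounded_linear_operator E NE M F NF M' T" and f: "f \<in> E"
    and fin: "lower_const E NE M (ennreal p) < \<infinity>" "upper_const F NF M' (ennreal q) < \<infinity>"
    and p: "0 < p" and pq: "p < q"
    and J: "finite J" "\<And>j. j \<in> J \<Longrightarrow> A j \<in> sets M"
      "\<And>i j. i \<in> J \<Longrightarrow> j \<in> J \<Longrightarrow> i < j \<Longrightarrow> A i \<subseteq> A j"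
  shows "(\<lambda>w. of_real (truncated_maximal J A T f w)) \<in> F"
    "NF (\<lambda>w. of_real (truncated_maximal J A T f w)) \<le>
       delta_quasi p (ennreal q) * enn2real (lower_const E NE M (ennreal p)) *
       enn2real (upper_const F NF M' (ennreal q)) * enn2real (operator_norm E NE NF T) * NE f"
proof -
  interpret E: quasi_banach_function_lattice M E NE by (rule E)
  interpret F: quasi_banach_function_lattice M' F NF by (rule F)
  let ?l = "enn2real (lower_const E NE M (ennreal p))"
  let ?t = "enn2real (operator_norm E NE NF T)"
  let ?u = "enn2real (upper_const F NF M' (ennreal q))"
  let ?W = "?t * (?l * NE f)"
  have q: "0 < q" using p pq by simp
  define \<kappa> where "\<kappa> = max 2 (2 powr (1 / q))"
  define \<tau> where "\<tau> = 1 / (1 / p - 1 / q)"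
  define D where "D = 1 + \<kappa> powr (- \<tau>)"
  define s where "s = D powr (- (p / q))"
  define K where "K = 1 / (1 - s powr (q / p))"
  define \<theta> where "\<theta> = (1 - s) powr (q / p) * K"
  have "0 < \<kappa>" by (simp add: \<kappa>_def)
  note split = splitting_ratio_constant[OF p pq this \<tau>_def D_def s_def K_def \<theta>_def]
  obtain L :: "nat \<Rightarrow> 'a set set" and n where L:
    "0 < n" "\<And>r. finite (L r)" "\<And>r. L r \<noteq> {}"
    "\<And>r B. B \<in> L r \<Longrightarrow> T (\<lambda>v. f v * indicator B v) \<in> F"
    "\<And>r. (\<Sum>B\<in>L r. NF (T (\<lambda>v. f v * indicator B v)) powr q) \<le> K * \<theta> ^ r * ?W powr q"
    "AE w in M'. \<exists>b. (\<forall>r<n. b r \<in> L r) \<and>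
       norm (of_real (truncated_maximal J A T f w) :: 'k)
         \<le> (\<Sum>r<n. norm (T (\<lambda>v. f v * indicator (b r) v) w))"
    by (rule maximal_levels[where A = A, OF E F T f fin(1) p q split(1,2) K_def \<theta>_def J]) (assumption | rule that)+
  define y where "y = \<theta> powr (1 / q)"
  have y: "0 \<le> y" "\<kappa> * y < 1" using split(5) by (simp_all add: y_def)
  note weights = dyadic_weights_bound[OF q y(1) \<kappa>_def y(2)]
  have y_powr: "(2 * y) powr q = 2 powr q * \<theta>"
    using q split(4) by (simp add: y_def powr_mult powr_powr)
  have W0: "0 \<le> ?W" using E.qnorm_nonneg[OF f] by simp
  note * = F.dyadic_level_bound[where h = "\<lambda>B. T (\<lambda>v. f v * indicator B v)" and L = L,
      OF fin(2) q L(1-5) less_imp_le[OF split(3)] split(4) W0 weights(1)[unfolded y_powr]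
      truncated_maximal_measurable[OF E F T f J(1,2)] L(6)]
  show "(\<lambda>w. of_real (truncated_maximal J A T f w)) \<in> F" by (rule *(1))
  note recip_ennreal[OF q]
  then have \<delta>: "delta_quasi p (ennreal q) = \<kappa> * K powr (1 / q) / (1 - \<kappa> * y)"
    unfolding y_def split(6) delta_quasi_def by (simp add: kappa_def tau_def \<kappa>_def \<tau>_def D_def)
  have "2 * (K / (1 - 2 powr q * \<theta>)) powr (1 / q)
      = K powr (1 / q) * (2 * (1 / (1 - (2 * y) powr q)) powr (1 / q))"
    unfolding y_powr by (simp add: powr_divide)
  also have "\<dots> \<le> K powr (1 / q) * (\<kappa> / (1 - \<kappa> * y))"
    by (intro mult_left_mono weights(2)) simp
  also have "\<dots> = delta_quasi p (ennreal q)" by (simp add: \<delta>)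
  finally have "?u * (?W * (2 * (K / (1 - 2 powr q * \<theta>)) powr (1 / q)))
      \<le> ?u * (?W * delta_quasi p (ennreal q))"
    using W0 by (intro mult_left_mono) auto
  moreover have "NF (\<lambda>w. of_real (truncated_maximal J A T f w))
      \<le> ?u * (2 * ?W * (K / (1 - 2 powr q * \<theta>)) powr (1 / q))"
    by (rule *(2))
  ultimately show "NF (\<lambda>w. of_real (truncated_maximal J A T f w))
      \<le> delta_quasi p (ennreal q) * ?l * ?u * ?t * NE f"
    by (simp add: mult_ac)
qed

text \<open>
  As \<open>F\<close> is normed, \<open>\<kappa> = 1\<close>, so that \<open>D = 1 + 1\<^bsup>-\<tau>\<^esup> = 2\<close>.
\<close>

lemma truncated_maximal_banach_bound:
  fixes p q :: real and A :: "'i::linorder \<Rightarrow> 'a set"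
    and E :: "('a \<Rightarrow> 'k::{real_normed_field, euclidean_space}) set"
  assumes E: "quasi_banach_function_lattice M E NE" and F: "banach_function_lattice M' F NF"
    and T: "bounded_linear_operator E NE M F NF M' T" and f: "f \<in> E"
    and fin: "lower_const E NE M (ennreal p) < \<infinity>" "upper_const F NF M' (ennreal q) < \<infinity>"
    and p: "0 < p" and pq: "p < q"
    and J: "finite J" "\<And>j. j \<in> J \<Longrightarrow> A j \<in> sets M"
      "\<And>i j. i \<in> J \<Longrightarrow> j \<in> J \<Longrightarrow> i < j \<Longrightarrow> A i \<subseteq> A j"
  shows "NF (\<lambda>w. of_real (truncated_maximal J A T f w)) \<le>
       delta_banach p (ennreal q) * enn2real (lower_const E NE M (ennreal p)) *
       enn2real (upper_const F NF M' (ennreal q)) * enn2real (operator_norm E NE NF T) * NE f"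
proof -
  interpret E: quasi_banach_function_lattice M E NE by (rule E)
  interpret F: banach_function_lattice M' F NF by (rule F)
  note F' = F.quasi_banach_function_lattice_axioms
  let ?l = "enn2real (lower_const E NE M (ennreal p))"
  let ?t = "enn2real (operator_norm E NE NF T)"
  let ?u = "enn2real (upper_const F NF M' (ennreal q))"
  let ?W = "?t * (?l * NE f)"
  have q: "0 < q" using p pq by simp
  define s where "s = (2::real) powr (- (p / q))"
  define K where "K = 1 / (1 - s powr (q / p))"
  define \<theta> where "\<theta> = (1 - s) powr (q / p) * K"
  have two: "(2::real) = 1 + 1 powr (- (1 / (1 / p - 1 / q)))" by simp
  note split = splitting_ratio_constant[OF p pq zero_less_one refl two s_def K_def \<theta>_def]
  obtain L :: "nat \<Rightarrow> 'a set set" and n where L: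
    "0 < n" "\<And>r. finite (L r)" "\<And>r. L r \<noteq> {}"
    "\<And>r B. B \<in> L r \<Longrightarrow> T (\<lambda>v. f v * indicator B v) \<in> F"
    "\<And>r. (\<Sum>B\<in>L r. NF (T (\<lambda>v. f v * indicator B v)) powr q) \<le> K * \<theta> ^ r * ?W powr q"
    "AE w in M'. \<exists>b. (\<forall>r<n. b r \<in> L r) \<and>
       norm (of_real (truncated_maximal J A T f w) :: 'k)
         \<le> (\<Sum>r<n. norm (T (\<lambda>v. f v * indicator (b r) v) w))"
    by (rule maximal_levels[where A = A, OF E F' T f fin(1) p q split(1,2) K_def \<theta>_def J]) (assumption | rule that)+
  have W0: "0 \<le> ?W" using E.qnorm_nonneg[OF f] by simp
  have small: "\<theta> powr (1 / q) < 1" using split(5) by simp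
  have "NF (\<lambda>w. of_real (truncated_maximal J A T f w))
      \<le> ?u * (?W * (K powr (1 / q) / (1 - \<theta> powr (1 / q))))"
    by (rule F.additive_level_bound[where h = "\<lambda>B. T (\<lambda>v. f v * indicator B v)" and L = L,
      OF fin(2) q L(2-5) less_imp_le[OF split(3)] split(4) W0 small
      truncated_maximal_measurable[OF E F' T f J(1,2)] L(6)])
  moreover note recip_ennreal[OF q]
  then have "delta_banach p (ennreal q) = K powr (1 / q) / (1 - \<theta> powr (1 / q))"
    using split(6) by (simp add: delta_banach_def)
  ultimately show ?thesis by (simp add: mult_ac)
qed

text \<open>
  The upper \<open>\<infinity>\<close>-estimate bounds the maximum of the functions \<open>T(f \<chi>\<^bsub>A\<^sub>j\<^esub>)\<close> by their largest quasi-norm, without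
  any decomposition.  The factors \<open>\<delta>\<close> and \<open>\<ell>\<close> can only enlarge the bound: the lower estimate
  for the single function \<open>f\<close> gives \<open>\<parallel>f\<parallel> \<le> \<ell> \<parallel>f\<parallel>\<close>.
\<close>

lemma truncated_maximal_infinity_bound:
  fixes p :: real and A :: "'i \<Rightarrow> 'a set"
    and E :: "('a \<Rightarrow> 'k::{real_normed_field, euclidean_space}) set"
  assumes E: "quasi_banach_function_lattice M E NE" and F: "quasi_banach_function_lattice M' F NF"
    and T: "bounded_linear_operator E NE M F NF M' T" and f: "f \<in> E"
    and fin: "lower_const E NE M (ennreal p) < \<infinity>" "upper_const F NF M' \<infinity> < \<infinity>"
    and p: "0 < p" and J: "finite J" "\<And>j. j \<in> J \<Longrightarrow> A j \<in> sets M" and \<delta>: "1 \<le> \<delta>"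
  shows "(\<lambda>w. of_real (truncated_maximal J A T f w)) \<in> F"
    "NF (\<lambda>w. of_real (truncated_maximal J A T f w)) \<le>
       \<delta> * enn2real (lower_const E NE M (ennreal p)) *
       enn2real (upper_const F NF M' \<infinity>) * enn2real (operator_norm E NE NF T) * NE f"
proof -
  interpret E: quasi_banach_function_lattice M E NE by (rule E)
  interpret F: quasi_banach_function_lattice M' F NF by (rule F)
  let ?l = "enn2real (lower_const E NE M (ennreal p))"
  let ?t = "enn2real (operator_norm E NE NF T)"
  let ?u = "enn2real (upper_const F NF M' \<infinity>)"
  let ?f = "\<lambda>B v. f v * indicator B v"
  let ?I = "insert {} (A ` J)"
  have I: "finite ?I" "?I \<noteq> {}" "?I \<subseteq> sets M" using J by auto
  have fB: "?f B \<in> E" "NE (?f B) \<le> NE f" if "B \<in> ?I" for B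
    using E.restrict_mem[OF f, of B] I(3) that by blast+
  have TF: "T (?f B) \<in> F" if "B \<in> ?I" for B
    by (rule bounded_linear_operatorD(1)[OF T fB(1)[OF that]])
  have le: "NF (T (?f B)) \<le> ?t * NE f" if "B \<in> ?I" for B
    using operator_norm_bound(2)[OF T fB(1)[OF that] E.qnorm_nonneg] fB(2)[OF that]
    by (meson enn2real_nonneg mult_left_mono order_trans)
  have dom: "AE w in M'. \<exists>B\<in>?I. norm (of_real (truncated_maximal J A T f w) :: 'k) \<le> norm (T (?f B) w)"
  proof (intro AE_I2)
    fix w
    show "\<exists>B\<in>?I. norm (of_real (truncated_maximal J A T f w) :: 'k) \<le> norm (T (?f B) w)"
      by (cases rule: truncated_maximal_cases[OF J(1), of A T f w]) auto
  qed
  note * = F.upper_estimate_dominated_infinity[OF fin(2) I(1,2) TF le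
      truncated_maximal_measurable[OF E F T f J] dom]
  show "(\<lambda>w. of_real (truncated_maximal J A T f w)) \<in> F" by (rule *(1))
  have N0: "0 \<le> NE f" by (rule E.qnorm_nonneg[OF f])
  have "NE f \<le> ?l * NE f"
    using E.lower_const_bound[OF fin(1), of 1 "\<lambda>j. f"] f p N0
    by (simp add: lp_sum_def powr_powr disjointly_supported_def)
  also have "\<dots> \<le> \<delta> * (?l * NE f)" 
    using \<delta> N0 mult_right_mono[of 1 \<delta> "?l * NE f"] by simp
  finally have "?u * (?t * NE f) \<le> ?u * (?t * (\<delta> * (?l * NE f)))"
    by (intro mult_left_mono) auto
  with *(2) show "NF (\<lambda>w. of_real (truncated_maximal J A T f w)) \<le> \<delta> * ?l * ?u * ?t * NE f"
    by (simp add: mult_ac)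
qed

theorem theorem3p2:
  fixes \<mu> :: "'a measure" and \<nu> :: "'b measure"
    and E :: "('a \<Rightarrow> 'k::{real_normed_field, euclidean_space}) set"
    and NE :: "('a \<Rightarrow> 'k) \<Rightarrow> real"
    and F :: "('b \<Rightarrow> 'k) set"
    and NF :: "('b \<Rightarrow> 'k) \<Rightarrow> real"
    and T :: "('a \<Rightarrow> 'k) \<Rightarrow> ('b \<Rightarrow> 'k)"
    and Q :: "'i::linorder set" and A :: "'i \<Rightarrow> 'a set"
    and p :: real and q :: ennreal
  assumes "quasi_banach_function_lattice \<mu> E NE"
    and "quasi_banach_function_lattice \<nu> F NF"
    and "bounded_linear_operator E NE \<mu> F NF \<nu> T"
    and "filtration \<mu> Q A"
    and "fatou_property F NF \<nu>"
    and "0 < p" and "ennreal p < q"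
    and "lower_estimate E NE \<mu> (ennreal p)"
    and "upper_estimate F NF \<nu> q"
  shows "maximal_operator_norm E NE F NF \<nu> Q A T
           \<le> ennreal (delta_quasi p q) * lower_const E NE \<mu> (ennreal p) * upper_const F NF \<nu> q
             * operator_norm E NE NF T
       \<and> (banach_function_lattice \<nu> F NF \<and> 1 \<le> q \<longrightarrow>
         maximal_operator_norm E NE F NF \<nu> Q A T
           \<le> ennreal (delta_banach p q) * lower_const E NE \<mu> (ennreal p) * upper_const F NF \<nu> q
             * operator_norm E NE NF T)"
proof -
  note E = assms(1) and F = assms(2) and T = assms(3)
  interpret E: quasi_banach_function_lattice \<mu> E NE by (rule E)
  interpret F: quasi_banach_function_lattice \<nu> F NF by (rule F)
  let ?g = "\<lambda>J f w. of_real (truncated_maximal J A T f w) :: 'k"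
  let ?l = "enn2real (lower_const E NE \<mu> (ennreal p))"
  let ?t = "enn2real (operator_norm E NE NF T)"
  let ?u = "enn2real (upper_const F NF \<nu> q)"
  have l: "lower_const E NE \<mu> (ennreal p) < \<infinity>" and u: "upper_const F NF \<nu> q < \<infinity>"
    using assms by (simp_all add: lower_estimate_def upper_estimate_def)
  have Q: "countable Q" and A: "\<And>j. j \<in> Q \<Longrightarrow> A j \<in> sets \<mu>"
    "\<And>i j. i \<in> Q \<Longrightarrow> j \<in> Q \<Longrightarrow> i < j \<Longrightarrow> A i \<subseteq> A j"
    using assms(4) unfolding filtration_def by blast+
  have A_sub: "\<And>j. j \<in> J \<Longrightarrow> A j \<in> sets \<mu>"
    "\<And>i j. i \<in> J \<Longrightarrow> j \<in> J \<Longrightarrow> i < j \<Longrightarrow> A i \<subseteq> A j" if "J \<subseteq> Q" for J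
    using A that by (meson subsetD)+
  have t: "operator_norm E NE NF T < \<infinity>"
    by (rule operator_norm_bound(1)[OF T E.zero_mem E.qnorm_nonneg])
  have conclude: "maximal_operator_norm E NE F NF \<nu> Q A T
      \<le> ennreal \<delta> * lower_const E NE \<mu> (ennreal p) * upper_const F NF \<nu> q * operator_norm E NE NF T"
    if \<delta>: "0 \<le> \<delta>" and mem: "\<And>f J. f \<in> E \<Longrightarrow> finite J \<Longrightarrow> J \<subseteq> Q \<Longrightarrow> ?g J f \<in> F"
      and bound: "\<And>f J. f \<in> E \<Longrightarrow> finite J \<Longrightarrow> J \<subseteq> Q \<Longrightarrow> NF (?g J f) \<le> \<delta> * ?l * ?u * ?t * NE f"
    for \<delta>
  proof -
    have "maximal_operator_norm E NE F NF \<nu> Q A T \<le> ennreal (\<delta> * ?l * ?u * ?t)"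
      using \<delta> by (intro maximal_operator_norm_le[OF E F assms(5) Q _ mem bound]) auto
    also have "\<dots> = ennreal \<delta> * ennreal ?l * ennreal ?u * ennreal ?t"
      using \<delta> by (simp add: ennreal_mult)
    finally show ?thesis using l u t by simp
  qed
  show ?thesis
  proof (cases q)
    case (real r)
    then have q: "q = ennreal r" by simp
    have pr: "p < r" using real  assms(6,7) by (simp add: ennreal_less_iff)
    note \<delta> = delta_nonneg[OF assms(6) pr, folded q]
    have quasi: "?g J f \<in> F" "NF (?g J f) \<le> delta_quasi p q * ?l * ?u * ?t * NE f"
      if f: "f \<in> E" and J: "finite J" "J \<subseteq> Q" for f J
      unfolding q
      by (rule truncated_maximal_quasi_bound[where A = A,
            OF E F T f l u[unfolded q] assms(6) pr J(1) A_sub[OF J(2)]]; assumption)+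
    have banach: "NF (?g J f) \<le> delta_banach p q * ?l * ?u * ?t * NE f"
      if F': "banach_function_lattice \<nu> F NF" and f: "f \<in> E" and J: "finite J" "J \<subseteq> Q" for f J
      unfolding q
      by (rule truncated_maximal_banach_bound[where A = A,
            OF E F' T f l u[unfolded q] assms(6) pr J(1) A_sub[OF J(2)]]; assumption)
    show ?thesis
    proof (intro conjI impI; (elim conjE)?)
      show "maximal_operator_norm E NE F NF \<nu> Q A T
           \<le> ennreal (delta_quasi p q) * lower_const E NE \<mu> (ennreal p) * upper_const F NF \<nu> q
             * operator_norm E NE NF T"
        by (rule conclude[OF \<delta>(1) quasi])
      assume F': "banach_function_lattice \<nu> F NF"
      show "maximal_operator_norm E NE F NF \<nu> Q A T
           \<le> ennreal (delta_banach p q) * lower_const E NE \<mu> (ennreal p) * upper_const F NF \<nu> q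
             * operator_norm E NE NF T"
        by (rule conclude[OF \<delta>(2) quasi(1) banach[OF F']])
    qed
  next
    case top
    then have q: "q = \<infinity>" by simp
    have "recip q = 0" by (simp add: recip_def top)
    moreover have "0 < 1 / (2::real) powr p" by simp
    then have "1 + 1 / 2 powr p \<noteq> (0::real)" by linarith
    ultimately have \<delta>: "1 \<le> delta_quasi p q" "1 \<le> delta_banach p q"
      using assms(6) by (simp_all add: delta_quasi_def delta_banach_def kappa_def tau_def powr_minus_divide)
    have direct: "?g J f \<in> F" "NF (?g J f) \<le> \<delta> * ?l * ?u * ?t * NE f"
      if \<delta>: "1 \<le> \<delta>" and f: "f \<in> E" and J: "finite J" "J \<subseteq> Q" for f J \<delta>
      unfolding q
      by (rule truncated_maximal_infinity_bound[where A = A,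
            OF E F T f l u[unfolded q] assms(6) J(1) A_sub(1)[OF J(2)] \<delta>]; assumption)+
    have "maximal_operator_norm E NE F NF \<nu> Q A T
        \<le> ennreal \<delta> * lower_const E NE \<mu> (ennreal p) * upper_const F NF \<nu> q * operator_norm E NE NF T"
      if \<delta>: "1 \<le> \<delta>" for \<delta>
      by (rule conclude[OF _ direct[OF \<delta>]]) (use \<delta> in simp_all)
    then show ?thesis using \<delta> by blast
  qed
qed

end
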